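(* The category $\mathsf{CExt}^2(\mathsf{Rck})$ of double coverings of racks is an $\mathcal{E}_2$-reflective subcategory of the category $\mathsf{Ext}^2(\mathsf{Rck})$ of double extensions of racks, i.e. the inclusion has a left adjoint $F_2$ and the components of the unit $\eta^2$ are $3$-fold extensions. Explicitly, for a double extension $\alpha=(\alpha_\top,\alpha_\perp)\colon f_A\to f_B$, let $C_2(\alpha)=[\mathrm{Eq}(f_A),\mathrm{Eq}(\alpha_\top)]$ and let $\eta^2_{A_\top}\colon A_\top\to F_2^i(A_\top)$ be the quotient of $A_\top$ by $C_2(\alpha)$. Since $C_2(\alpha)\le\mathrm{Eq}(f_A)\cap\mathrm{Eq}(\alpha_\top)$, the comparison map $p\colon A_\top\to A_\perp\times_{B_\perp}B_\top$ of $\alpha$ factors uniquely as $p=p'\eta^2_{A_\top}$. With $\pi_1,\pi_2$ the projections of $A_\perp\times_{B_\perp}B_\top$ to $A_\perp$ and $B_\top$, the reflection of $\alpha$ is the double extension $F_2(\alpha)=(\pi_2p',\alpha_\perp)$ from $\pi_1p'\colon F_2^i(A_\top)\to A_\perp$ to $f_B$, and the unit is $\eta^2_\alpha=((\eta^2_{A_\top},\mathrm{id}_{A_\perp}),(\mathrm{id}_{B_\top},\mathrm{id}_{B_\perp}))\colon\alpha\to F_2(\alpha)$. The image by $F_2$ of a morphism $(\sigma,\beta)\colon\gamma\to\alpha$ of double extensions, where $\gamma\colon f_C\to f_D$, is $((F_2^i(\sigma_\top),\sigma_\perp),(\beta_\top,\beta_\perp))$, where $F_2^i(\sigma_\top)\colon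 F_2^i(C_\top)\to F_2^i(A_\top)$ is the unique morphism with $F_2^i(\sigma_\top)\,\eta^2_{C_\top}=\eta^2_{A_\top}\sigma_\top$.
   Context: A rack is a set $A$ with binary operations $\triangleleft,\triangleleft^{-1}$ such that $(x\triangleleft a)\triangleleft^{-1}a=x=(x\triangleleft^{-1}a)\triangleleft a$ and $(x\triangleleft a)\triangleleft b=(x\triangleleft b)\triangleleft(a\triangleleft b)$ for all $x,a,b\in A$. Morphisms are functions preserving $\triangleleft$; $\mathsf{Rck}$ is the category of racks. Unbracketed expressions are evaluated from left to right. $\mathrm{Eq}(f)$ is the kernel pair $\{(a,b)\mid f(a)=f(b)\}$. An extension is a surjective morphism of racks. $\mathsf{Ext}(\mathsf{Rck})$ is the category whose objects are extensions and whose morphisms $\alpha=(\alpha_\top,\alpha_\perp)\colon f_A\to f_B$, for $f_A\colon A_\top\to A_\perp$ and $f_B\colon B_\top\to B_\perp$, are pairs $\alpha_\top\colon A_\top\to B_\top$, $\alpha_\perp\colon A_\perp\to B_\perp$ with $f_B\alpha_\top=\alpha_\perp f_A$. Such an $\alpha$ is a double extension if $\alpha_\top$, $\alpha_\perp$ and the comparison map $A_\top\to A_\perp\times_{B_\perp}B_\top$ induced by $f_A$ and $\alpha_\top$ are all surjective. Pullbacks along double extensions in $\mathsf{Ext}(\mathsf{Rck})$ are computed component-wise. $\mathsf{Ext}^2(\mathsf{Rck})$ is the category whose objects are double extensions and whose morphisms $(\sigma,\beta)\colon\gamma\to\alpha$, with $\gamma\colon f_C\to f_D$ and $\alpha\colon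 f_A\to f_B$, are pairs of morphisms $\sigma=(\sigma_\top,\sigma_\perp)\colon f_C\to f_A$, $\beta=(\beta_\top,\beta_\perp)\colon f_D\to f_B$ of $\mathsf{Ext}(\mathsf{Rck})$ with $\alpha\sigma=\beta\gamma$. Such a morphism is a $3$-fold extension if $\sigma$, $\beta$ and the comparison morphism $f_C\to f_D\times_{f_B}f_A$ (pullback in $\mathsf{Ext}(\mathsf{Rck})$) are double extensions; $\mathcal{E}_2$ is the class of $3$-fold extensions. For congruences $R,S$ on a rack $A$, $R\,\square\,S$ is the set of $(a,b,c,d)\in A^4$ with $(a,b),(d,c)\in R$ and $(a,d),(b,c)\in S$, and $[R,S]$ is the congruence on $A$ generated by the pairs $(x\triangleleft a\triangleleft^{-1}b\triangleleft c\triangleleft^{-1}d,\ x)$ with $x\in A$, $(a,b,c,d)\in R\,\square\,S$. A double extension $\alpha\colon f_A\to f_B$ is a double covering if $x\triangleleft a\triangleleft^{-1}b\triangleleft c\triangleleft^{-1}d=x$ for all $x\in A_\top$ and $(a,b,c,d)\in\mathrm{Eq}(f_A)\,\square\,\mathrm{Eq}(\alpha_\top)$. $\mathsf{CExt}^2(\mathsf{Rck})$ is the full subcategory of $\mathsf{Ext}^2(\mathsf{Rck})$ of double coverings. *)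

theory Defs
  imports Main "HOL-Library.FuncSet"
begin

section \<open>Categories, functors, reflective subcategories\<close>

text \<open>Categories are given by families of hom-sets. The arguments of \<open>Comp X Y Z g f\<close> are the
  objects of \<open>f : X \<rightarrow> Y\<close> and \<open>g : Y \<rightarrow> Z\<close>.\<close>

record ('o, 'm) cat =
  Ob :: "'o set"
  Hom :: "'o \<Rightarrow> 'o \<Rightarrow> 'm set"
  Comp :: "'o \<Rightarrow> 'o \<Rightarrow> 'o \<Rightarrow> 'm \<Rightarrow> 'm \<Rightarrow> 'm"
  Idt :: "'o \<Rightarrow> 'm"

locale category =
  fixes C :: "('o, 'm) cat"
  assumes Idt_in: "X \<in> Ob C \<Longrightarrow> Idt C X \<in> Hom C X X"
    and Comp_in: "\<lbrakk>X \<in> Ob C; Y \<in> Ob C; Z \<in> Ob C; f \<in> Hom C X Y; g \<in> Hom C Y Z\<rbrakk>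
      \<Longrightarrow> Comp C X Y Z g f \<in> Hom C X Z"
    and Comp_Idt: "\<lbrakk>X \<in> Ob C; Y \<in> Ob C; f \<in> Hom C X Y\<rbrakk> \<Longrightarrow> Comp C X X Y f (Idt C X) = f"
    and Idt_Comp: "\<lbrakk>X \<in> Ob C; Y \<in> Ob C; f \<in> Hom C X Y\<rbrakk> \<Longrightarrow> Comp C X Y Y (Idt C Y) f = f"
    and Comp_assoc: "\<lbrakk>W \<in> Ob C; X \<in> Ob C; Y \<in> Ob C; Z \<in> Ob C;
        f \<in> Hom C W X; g \<in> Hom C X Y; h \<in> Hom C Y Z\<rbrakk>
      \<Longrightarrow> Comp C W Y Z h (Comp C W X Y g f) = Comp C W X Z (Comp C X Y Z h g) f"

record ('o, 'm, 'p, 'n) cat_functor =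
  on_Ob :: "'o \<Rightarrow> 'p"
  on_Hom :: "'o \<Rightarrow> 'o \<Rightarrow> 'm \<Rightarrow> 'n"

definition is_functor ::
  "('o, 'm) cat \<Rightarrow> ('p, 'n) cat \<Rightarrow> ('o, 'm, 'p, 'n) cat_functor \<Rightarrow> bool" where
  "is_functor C D F \<longleftrightarrow> category C \<and> category D
    \<and> (\<forall>X\<in>Ob C. on_Ob F X \<in> Ob D)
    \<and> (\<forall>X\<in>Ob C. \<forall>Y\<in>Ob C. \<forall>f\<in>Hom C X Y. on_Hom F X Y f \<in> Hom D (on_Ob F X) (on_Ob F Y))
    \<and> (\<forall>X\<in>Ob C. on_Hom F X X (Idt C X) = Idt D (on_Ob F X))
    \<and> (\<forall>X\<in>Ob C. \<forall>Y\<in>Ob C. \<forall>Z\<in>Ob C. \<forall>f\<in>Hom C X Y. \<forall>g\<in>Hom C Y Z.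
        on_Hom F X Z (Comp C X Y Z g f) =
        Comp D (on_Ob F X) (on_Ob F Y) (on_Ob F Z) (on_Hom F Y Z g) (on_Hom F X Y f))"

text \<open>\<open>F : C \<rightarrow> D\<close> is left adjoint to \<open>G : D \<rightarrow> C\<close> with unit \<open>\<eta> : 1 \<rightarrow> GF\<close>: the unit is natural
  and the maps \<open>D(FX, Y) \<rightarrow> C(X, GY)\<close>, \<open>g \<mapsto> Gg \<circ> \<eta>\<^sub>X\<close>, which are then natural in \<open>X\<close> and \<open>Y\<close>,
  are bijections.\<close>

definition left_adjoint_with_unit ::
  "('o, 'm) cat \<Rightarrow> ('p, 'n) cat \<Rightarrow> ('o, 'm, 'p, 'n) cat_functor \<Rightarrow>
    ('p, 'n, 'o, 'm) cat_functor \<Rightarrow> ('o \<Rightarrow> 'm) \<Rightarrow> bool" where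
  "left_adjoint_with_unit C D F G \<eta> \<longleftrightarrow>
    is_functor C D F \<and> is_functor D C G
    \<and> (\<forall>X\<in>Ob C. \<eta> X \<in> Hom C X (on_Ob G (on_Ob F X)))
    \<and> (\<forall>X\<in>Ob C. \<forall>Y\<in>Ob C. \<forall>f\<in>Hom C X Y.
        Comp C X Y (on_Ob G (on_Ob F Y)) (\<eta> Y) f =
        Comp C X (on_Ob G (on_Ob F X)) (on_Ob G (on_Ob F Y))
          (on_Hom G (on_Ob F X) (on_Ob F Y) (on_Hom F X Y f)) (\<eta> X))
    \<and> (\<forall>X\<in>Ob C. \<forall>Y\<in>Ob D.
        bij_betw (\<lambda>g. Comp C X (on_Ob G (on_Ob F X)) (on_Ob G Y)
                        (on_Hom G (on_Ob F X) Y g) (\<eta> X))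
          (Hom D (on_Ob F X) Y) (Hom C X (on_Ob G Y)))"

definition full_subcat :: "('o, 'm) cat \<Rightarrow> 'o set \<Rightarrow> ('o, 'm) cat" where
  "full_subcat C P = C\<lparr>Ob := Ob C \<inter> P\<rparr>"

definition inclusion :: "('o, 'm, 'o, 'm) cat_functor" where
  "inclusion = \<lparr>on_Ob = (\<lambda>X. X), on_Hom = (\<lambda>X Y f. f)\<rparr>"

text \<open>The full subcategory of \<open>C\<close> on the objects in \<open>P\<close> is \<open>\<E>\<close>-reflective, with reflector \<open>F\<close>
  and unit \<open>\<eta>\<close>; a class of morphisms is a set of triples (source, target, morphism).\<close>

definition reflective_with ::
  "('o, 'm) cat \<Rightarrow> 'o set \<Rightarrow> ('o \<times> 'o \<times> 'm) set \<Rightarrow> ('o, 'm, 'o, 'm) cat_functor \<Rightarrow>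
    ('o \<Rightarrow> 'm) \<Rightarrow> bool" where
  "reflective_with C P \<E> F \<eta> \<longleftrightarrow>
    left_adjoint_with_unit C (full_subcat C P) F inclusion \<eta>
    \<and> (\<forall>X\<in>Ob C. (X, on_Ob F X, \<eta> X) \<in> \<E>)"


section \<open>Racks\<close>

record 'a rack =
  carrier :: "'a set"
  act :: "'a \<Rightarrow> 'a \<Rightarrow> 'a" (infixl "\<lhd>\<index>" 70)
  inv_act :: "'a \<Rightarrow> 'a \<Rightarrow> 'a" (infixl "\<lhd>\<inverse>\<index>" 70)

locale rack =
  fixes A :: "'a rack" (structure)
  assumes act_closed: "\<lbrakk>x \<in> carrier A; a \<in> carrier A\<rbrakk> \<Longrightarrow> x \<lhd> a \<in> carrier A"
    and inv_act_closed: "\<lbrakk>x \<in> carrier A; a \<in> carrier A\<rbrakk> \<Longrightarrow> x \<lhd>\<inverse> a \<in> carrier A"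
    and act_inv_act: "\<lbrakk>x \<in> carrier A; a \<in> carrier A\<rbrakk> \<Longrightarrow> (x \<lhd> a) \<lhd>\<inverse> a = x"
    and inv_act_act: "\<lbrakk>x \<in> carrier A; a \<in> carrier A\<rbrakk> \<Longrightarrow> (x \<lhd>\<inverse> a) \<lhd> a = x"
    and self_distrib: "\<lbrakk>x \<in> carrier A; a \<in> carrier A; b \<in> carrier A\<rbrakk>
      \<Longrightarrow> (x \<lhd> a) \<lhd> b = (x \<lhd> b) \<lhd> (a \<lhd> b)"

text \<open>Maps between carriers are extensional functions, so that HOL equality of functions is
  equality of morphisms; accordingly composition is \<^const>\<open>compose\<close> on the source carrier.\<close>

definition rack_hom :: "'a rack \<Rightarrow> 'b rack \<Rightarrow> ('a \<Rightarrow> 'b) set" where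
  "rack_hom A B = {f \<in> carrier A \<rightarrow>\<^sub>E carrier B.
    \<forall>x\<in>carrier A. \<forall>y\<in>carrier A. f (x \<lhd>\<^bsub>A\<^esub> y) = f x \<lhd>\<^bsub>B\<^esub> f y}"

definition rack_id :: "'a rack \<Rightarrow> 'a \<Rightarrow> 'a" where
  "rack_id A = (\<lambda>x\<in>carrier A. x)"

definition rack_surj :: "'a rack \<Rightarrow> 'b rack \<Rightarrow> ('a \<Rightarrow> 'b) set" where
  "rack_surj A B = {f \<in> rack_hom A B. f ` carrier A = carrier B}"

definition Eq :: "'a rack \<Rightarrow> ('a \<Rightarrow> 'b) \<Rightarrow> ('a \<times> 'a) set" where
  "Eq A f = {(a, b) \<in> carrier A \<times> carrier A. f a = f b}"

text \<open>The pullback of \<open>u : A \<rightarrow> D\<close> and \<open>v : B \<rightarrow> D\<close>.\<close>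

definition rack_pullback ::
  "'a rack \<Rightarrow> 'b rack \<Rightarrow> ('a \<Rightarrow> 'd) \<Rightarrow> ('b \<Rightarrow> 'd) \<Rightarrow> ('a \<times> 'b) rack" where
  "rack_pullback A B u v =
    \<lparr>carrier = {(x, y) \<in> carrier A \<times> carrier B. u x = v y},
     act = (\<lambda>(x, y) (a, b). (x \<lhd>\<^bsub>A\<^esub> a, y \<lhd>\<^bsub>B\<^esub> b)),
     inv_act = (\<lambda>(x, y) (a, b). (x \<lhd>\<inverse>\<^bsub>A\<^esub> a, y \<lhd>\<inverse>\<^bsub>B\<^esub> b))\<rparr>"

definition congruence :: "'a rack \<Rightarrow> ('a \<times> 'a) set \<Rightarrow> bool" where
  "congruence A R \<longleftrightarrow> equiv (carrier A) R
    \<and> (\<forall>(x, y)\<in>R. \<forall>(a, b)\<in>R. (x \<lhd>\<^bsub>A\<^esub> a, y \<lhd>\<^bsub>A\<^esub> b) \<in> R \<and> (x \<lhd>\<inverse>\<^bsub>A\<^esub> a, y \<lhd>\<inverse>\<^bsub>A\<^esub> b) \<in> R)"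

definition cong_gen :: "'a rack \<Rightarrow> ('a \<times> 'a) set \<Rightarrow> ('a \<times> 'a) set" where
  "cong_gen A P = \<Inter>{R. congruence A R \<and> P \<subseteq> R}"

text \<open>The quotient of \<open>A\<close> by \<open>R\<close>. To have the quotient of a rack on a type again on that type, the
  elements are not the equivalence classes themselves but one chosen representative per class;
  the quotient map sends \<open>x\<close> to the representative of its class.\<close>

definition quot_proj :: "'a rack \<Rightarrow> ('a \<times> 'a) set \<Rightarrow> 'a \<Rightarrow> 'a" where
  "quot_proj A R = (\<lambda>x\<in>carrier A. SOME y. y \<in> R `` {x})"

definition quot_rack :: "'a rack \<Rightarrow> ('a \<times> 'a) set \<Rightarrow> 'a rack" where
  "quot_rack A R =
    \<lparr>carrier = quot_proj A R ` carrier A,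
     act = (\<lambda>x a. quot_proj A R (x \<lhd>\<^bsub>A\<^esub> a)),
     inv_act = (\<lambda>x a. quot_proj A R (x \<lhd>\<inverse>\<^bsub>A\<^esub> a))\<rparr>"

definition square :: "('a \<times> 'a) set \<Rightarrow> ('a \<times> 'a) set \<Rightarrow> ('a \<times> 'a \<times> 'a \<times> 'a) set"
    (infix "\<box>" 75) where
  "R \<box> S = {(a, b, c, d). (a, b) \<in> R \<and> (d, c) \<in> R \<and> (a, d) \<in> S \<and> (b, c) \<in> S}"

definition commutator :: "'a rack \<Rightarrow> ('a \<times> 'a) set \<Rightarrow> ('a \<times> 'a) set \<Rightarrow> ('a \<times> 'a) set" where
  "commutator A R S = cong_gen A
    {(x \<lhd>\<^bsub>A\<^esub> a \<lhd>\<inverse>\<^bsub>A\<^esub> b \<lhd>\<^bsub>A\<^esub> c \<lhd>\<inverse>\<^bsub>A\<^esub> d, x) | x a b c d. x \<in> carrier A \<and> (a, b, c, d) \<in> R \<box> S}"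


section \<open>Extensions and their morphisms\<close>

record 'a ext =
  etop :: "'a rack"
  ebot :: "'a rack"
  emap :: "'a \<Rightarrow> 'a"

definition extension :: "'a ext \<Rightarrow> bool" where
  "extension f \<longleftrightarrow> rack (etop f) \<and> rack (ebot f) \<and> emap f \<in> rack_surj (etop f) (ebot f)"

text \<open>Morphisms of extensions are pairs (top component, bottom component).\<close>

type_synonym ('a, 'b) ext_mor = "('a \<Rightarrow> 'b) \<times> ('a \<Rightarrow> 'b)"

definition ext_hom :: "'a ext \<Rightarrow> 'b ext \<Rightarrow> ('a, 'b) ext_mor set" where
  "ext_hom f g = {(t, b). t \<in> rack_hom (etop f) (etop g) \<and> b \<in> rack_hom (ebot f) (ebot g)
    \<and> compose (carrier (etop f)) (emap g) t = compose (carrier (etop f)) b (emap f)}"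

definition ext_comp ::
  "'a ext \<Rightarrow> ('b, 'c) ext_mor \<Rightarrow> ('a, 'b) ext_mor \<Rightarrow> ('a, 'c) ext_mor" where
  "ext_comp f m n =
    (compose (carrier (etop f)) (fst m) (fst n), compose (carrier (ebot f)) (snd m) (snd n))"

definition ext_id :: "'a ext \<Rightarrow> ('a, 'a) ext_mor" where
  "ext_id f = (rack_id (etop f), rack_id (ebot f))"

text \<open>For \<open>m : f \<rightarrow> g\<close>, the rack \<open>A\<^sub>\<bottom> \<times>\<^bsub>B\<^sub>\<bottom>\<^esub> B\<^sub>\<top>\<close> and the comparison map to it.\<close>

definition comparison_cod :: "'a ext \<Rightarrow> 'b ext \<Rightarrow> ('a, 'b) ext_mor \<Rightarrow> ('a \<times> 'b) rack" where
  "comparison_cod f g m = rack_pullback (ebot f) (etop g) (snd m) (emap g)"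

definition comparison :: "'a ext \<Rightarrow> ('a, 'b) ext_mor \<Rightarrow> 'a \<Rightarrow> 'a \<times> 'b" where
  "comparison f m = (\<lambda>x\<in>carrier (etop f). (emap f x, fst m x))"

definition double_extension :: "'a ext \<Rightarrow> 'b ext \<Rightarrow> ('a, 'b) ext_mor \<Rightarrow> bool" where
  "double_extension f g m \<longleftrightarrow> extension f \<and> extension g \<and> m \<in> ext_hom f g
    \<and> fst m ` carrier (etop f) = carrier (etop g)
    \<and> snd m ` carrier (ebot f) = carrier (ebot g)
    \<and> comparison f m ` carrier (etop f) = carrier (comparison_cod f g m)"

text \<open>The component-wise pullback of \<open>m : f \<rightarrow> h\<close> and \<open>n : g \<rightarrow> h\<close>, and the morphism into it
  induced by \<open>r : k \<rightarrow> f\<close> and \<open>s : k \<rightarrow> g\<close>.\<close>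

definition ext_pullback ::
  "'a ext \<Rightarrow> 'b ext \<Rightarrow> ('a, 'd) ext_mor \<Rightarrow> ('b, 'd) ext_mor \<Rightarrow> ('a \<times> 'b) ext" where
  "ext_pullback f g m n =
    \<lparr>etop = rack_pullback (etop f) (etop g) (fst m) (fst n),
     ebot = rack_pullback (ebot f) (ebot g) (snd m) (snd n),
     emap = (\<lambda>(x, y)\<in>carrier (rack_pullback (etop f) (etop g) (fst m) (fst n)).
               (emap f x, emap g y))\<rparr>"

definition ext_pair ::
  "'k ext \<Rightarrow> ('k, 'a) ext_mor \<Rightarrow> ('k, 'b) ext_mor \<Rightarrow> ('k, 'a \<times> 'b) ext_mor" where
  "ext_pair k r s =
    ((\<lambda>x\<in>carrier (etop k). (fst r x, fst s x)), (\<lambda>x\<in>carrier (ebot k). (snd r x, snd s x)))"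


section \<open>Double extensions and 3-fold extensions\<close>

record 'a arrow =
  src :: "'a ext"
  tgt :: "'a ext"
  mor :: "('a, 'a) ext_mor"

definition dext :: "'a arrow set" where
  "dext = {\<alpha>. double_extension (src \<alpha>) (tgt \<alpha>) (mor \<alpha>)}"

type_synonym ('a, 'b) arrow_mor = "('a, 'b) ext_mor \<times> ('a, 'b) ext_mor"

definition arrow_hom :: "'a arrow \<Rightarrow> 'b arrow \<Rightarrow> ('a, 'b) arrow_mor set" where
  "arrow_hom \<gamma> \<alpha> = {(\<sigma>, \<beta>). \<sigma> \<in> ext_hom (src \<gamma>) (src \<alpha>) \<and> \<beta> \<in> ext_hom (tgt \<gamma>) (tgt \<alpha>)
    \<and> ext_comp (src \<gamma>) (mor \<alpha>) \<sigma> = ext_comp (src \<gamma>) \<beta> (mor \<gamma>)}"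

definition arrow_comp ::
  "'a arrow \<Rightarrow> ('b, 'c) arrow_mor \<Rightarrow> ('a, 'b) arrow_mor \<Rightarrow> ('a, 'c) arrow_mor" where
  "arrow_comp \<gamma> m n = (ext_comp (src \<gamma>) (fst m) (fst n), ext_comp (tgt \<gamma>) (snd m) (snd n))"

definition arrow_id :: "'a arrow \<Rightarrow> ('a, 'a) arrow_mor" where
  "arrow_id \<alpha> = (ext_id (src \<alpha>), ext_id (tgt \<alpha>))"

definition three_fold_extension :: "'a arrow \<Rightarrow> 'b arrow \<Rightarrow> ('a, 'b) arrow_mor \<Rightarrow> bool" where
  "three_fold_extension \<gamma> \<alpha> m \<longleftrightarrow> \<gamma> \<in> dext \<and> \<alpha> \<in> dext \<and> m \<in> arrow_hom \<gamma> \<alpha>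
    \<and> double_extension (src \<gamma>) (src \<alpha>) (fst m)
    \<and> double_extension (tgt \<gamma>) (tgt \<alpha>) (snd m)
    \<and> double_extension (src \<gamma>) (ext_pullback (tgt \<gamma>) (src \<alpha>) (snd m) (mor \<alpha>))
        (ext_pair (src \<gamma>) (mor \<gamma>) (fst m))"

text \<open>The type \<^typ>\<open>'a\<close> plays the role of an arbitrary universe: the racks involved are those
  carried by subsets of it.\<close>

definition Ext2 :: "('a arrow, ('a, 'a) arrow_mor) cat" where
  "Ext2 = \<lparr>Ob = dext, Hom = arrow_hom, Comp = (\<lambda>\<gamma> \<alpha> \<delta> m n. arrow_comp \<gamma> m n), Idt = arrow_id\<rparr>"

definition E2 :: "('a arrow \<times> 'a arrow \<times> ('a, 'a) arrow_mor) set" where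
  "E2 = {(\<gamma>, \<alpha>, m). three_fold_extension \<gamma> \<alpha> m}"

definition double_coverings :: "'a arrow set" where
  "double_coverings = {\<alpha> \<in> dext. let A = etop (src \<alpha>) in
    \<forall>x\<in>carrier A. \<forall>(a, b, c, d) \<in> Eq A (emap (src \<alpha>)) \<box> Eq A (fst (mor \<alpha>)).
      x \<lhd>\<^bsub>A\<^esub> a \<lhd>\<inverse>\<^bsub>A\<^esub> b \<lhd>\<^bsub>A\<^esub> c \<lhd>\<inverse>\<^bsub>A\<^esub> d = x}"


section \<open>The reflector\<close>

text \<open>The definite descriptions below (the factorization \<open>p'\<close> of the comparison map through the
  quotient, and the map induced between quotients) are meaningful for double extensions and their
  morphisms, where the described maps exist uniquely.\<close>

definition C2 :: "'a arrow \<Rightarrow> ('a \<times> 'a) set" where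
  "C2 \<alpha> = commutator (etop (src \<alpha>))
    (Eq (etop (src \<alpha>)) (emap (src \<alpha>))) (Eq (etop (src \<alpha>)) (fst (mor \<alpha>)))"

definition F2i :: "'a arrow \<Rightarrow> 'a rack" where
  "F2i \<alpha> = quot_rack (etop (src \<alpha>)) (C2 \<alpha>)"

definition eta2_top :: "'a arrow \<Rightarrow> 'a \<Rightarrow> 'a" where
  "eta2_top \<alpha> = quot_proj (etop (src \<alpha>)) (C2 \<alpha>)"

definition is_comparison_factor :: "'a arrow \<Rightarrow> ('a \<Rightarrow> 'a \<times> 'a) \<Rightarrow> bool" where
  "is_comparison_factor \<alpha> p' \<longleftrightarrow>
    p' \<in> rack_hom (F2i \<alpha>) (comparison_cod (src \<alpha>) (tgt \<alpha>) (mor \<alpha>))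
    \<and> comparison (src \<alpha>) (mor \<alpha>) = compose (carrier (etop (src \<alpha>))) p' (eta2_top \<alpha>)"

definition F2_Ob :: "'a arrow \<Rightarrow> 'a arrow" where
  "F2_Ob \<alpha> = (let p' = (THE p'. is_comparison_factor \<alpha> p') in
    \<lparr>src = \<lparr>etop = F2i \<alpha>, ebot = ebot (src \<alpha>), emap = compose (carrier (F2i \<alpha>)) fst p'\<rparr>,
     tgt = tgt \<alpha>,
     mor = (compose (carrier (F2i \<alpha>)) snd p', snd (mor \<alpha>))\<rparr>)"

definition eta2 :: "'a arrow \<Rightarrow> ('a, 'a) arrow_mor" where
  "eta2 \<alpha> = ((eta2_top \<alpha>, rack_id (ebot (src \<alpha>))),
    (rack_id (etop (tgt \<alpha>)), rack_id (ebot (tgt \<alpha>))))"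

definition is_F2i_map :: "'a arrow \<Rightarrow> 'a arrow \<Rightarrow> ('a \<Rightarrow> 'a) \<Rightarrow> ('a \<Rightarrow> 'a) \<Rightarrow> bool" where
  "is_F2i_map \<gamma> \<alpha> s h \<longleftrightarrow> h \<in> rack_hom (F2i \<gamma>) (F2i \<alpha>)
    \<and> compose (carrier (etop (src \<gamma>))) h (eta2_top \<gamma>) =
      compose (carrier (etop (src \<gamma>))) (eta2_top \<alpha>) s"

definition F2_Hom :: "'a arrow \<Rightarrow> 'a arrow \<Rightarrow> ('a, 'a) arrow_mor \<Rightarrow> ('a, 'a) arrow_mor" where
  "F2_Hom \<gamma> \<alpha> m = (case m of ((s, s'), \<beta>) \<Rightarrow> ((THE h. is_F2i_map \<gamma> \<alpha> s h, s'), \<beta>))"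

definition F2 :: "('a arrow, ('a, 'a) arrow_mor, 'a arrow, ('a, 'a) arrow_mor) cat_functor" where
  "F2 = \<lparr>on_Ob = F2_Ob, on_Hom = F2_Hom\<rparr>"

end

theory Submission
  imports Defs
begin

text \<open>
  The unit of the reflection is the identity in three of its four components, so everything happens
  on the initial rack \<open>A\<^sub>\<top>\<close> and comes from the universal property of a quotient: a morphism of
  racks whose kernel pair contains a congruence \<open>R\<close> factors uniquely through the quotient by \<open>R\<close>
  (\<open>ex1_quot_factor\<close>). It is used three times, always for \<open>R = C\<^sub>2(\<alpha>)\<close>, which lies in the kernel
  pair of a morphism as soon as that morphism identifies \<open>x \<lhd> a \<lhd>\<inverse> b \<lhd> c \<lhd>\<inverse> d\<close> with \<open>x\<close> on all
  squares (\<open>C2_subset_EqI\<close>).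

  For the comparison map this holds because both coordinates collapse such an expression: \<open>f\<^sub>A\<close>
  makes \<open>a, b\<close> equal and \<open>c, d\<close> equal, \<open>\<alpha>\<^sub>\<top>\<close> makes \<open>b, c\<close> equal and then \<open>a, d\<close>. This gives \<open>p'\<close>, and
  hence the object \<open>F\<^sub>2(\<alpha>)\<close>. It inherits surjectivity of its comparison map from \<open>\<alpha>\<close>. It is a double
  covering because \<open>f\<^sub>A\<close> and \<open>\<alpha>\<^sub>\<top>\<close> factor through the quotient map, so that every square of \<open>F\<^sub>2(\<alpha>)\<close>
  lifts, corner by corner, to a square of \<open>\<alpha>\<close> (\<open>F2_Ob_covering\<close>).

  For the top component of a morphism from \<open>\<alpha>\<close> to a double covering the condition holds because
  morphisms of double extensions send squares to squares (\<open>C2_subset_Eq_hom\<close>). The resulting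
  factorization is the universal property of the unit (\<open>ex1_F2_Ob_factor\<close>): the other components of
  a factorization are forced, and all equations between maps out of the quotient can be checked after
  composition with the surjective quotient map. Applied to the composite of a morphism with a unit,
  it gives the action of \<open>F\<^sub>2\<close> on morphisms, and uniqueness gives functoriality.

  The unit is a \<open>3\<close>-fold extension because all pullbacks that occur are pullbacks along identities
  or other isomorphisms: an element of one is determined by a single coordinate, which lies in the
  quotient, in \<open>A\<^sub>\<bottom>\<close> or in \<open>B\<^sub>\<top>\<close>, and every value of that coordinate is attained because the
  quotient map and \<open>f\<^sub>A\<close> are surjective (\<open>eta2_three_fold\<close>).
\<close>

section \<open>Morphisms of racks\<close>

lemma rack_homI:
  assumes "\<And>x. x \<in> carrier A \<Longrightarrow> f x \<in> carrier B" and "f \<in> extensional (carrier A)"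
    and "\<And>x y. x \<in> carrier A \<Longrightarrow> y \<in> carrier A \<Longrightarrow> f (x \<lhd>\<^bsub>A\<^esub> y) = f x \<lhd>\<^bsub>B\<^esub> f y"
  shows "f \<in> rack_hom A B"
  using assms by (auto simp: rack_hom_def PiE_iff)

lemma rack_hom_closed: "f \<in> rack_hom A B \<Longrightarrow> x \<in> carrier A \<Longrightarrow> f x \<in> carrier B"
  by (auto simp: rack_hom_def)

lemma rack_hom_act:
  "f \<in> rack_hom A B \<Longrightarrow> x \<in> carrier A \<Longrightarrow> y \<in> carrier A \<Longrightarrow> f (x \<lhd>\<^bsub>A\<^esub> y) = f x \<lhd>\<^bsub>B\<^esub> f y"
  by (auto simp: rack_hom_def)

lemma rack_hom_extensional: "f \<in> rack_hom A B \<Longrightarrow> f \<in> extensional (carrier A)"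
  by (auto simp: rack_hom_def PiE_iff)

text \<open>The inverse operation is determined by \<open>\<lhd>\<close>: both sides become \<open>f x\<close> after acting by \<open>f a\<close>.\<close>

lemma rack_hom_inv_act:
  assumes "rack A" "rack B" "f \<in> rack_hom A B" "x \<in> carrier A" "a \<in> carrier A"
  shows "f (x \<lhd>\<inverse>\<^bsub>A\<^esub> a) = f x \<lhd>\<inverse>\<^bsub>B\<^esub> f a"
proof -
  interpret A: rack A by fact
  interpret B: rack B by fact
  have "f x = f (x \<lhd>\<inverse>\<^bsub>A\<^esub> a) \<lhd>\<^bsub>B\<^esub> f a"
    using assms rack_hom_act[OF assms(3), of "x \<lhd>\<inverse>\<^bsub>A\<^esub> a" a] by (simp add: A.inv_act_closed A.inv_act_act)
  then show ?thesis
    using assms by (simp add: B.act_inv_act rack_hom_closed A.inv_act_closed)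
qed

lemma rack_hom_compose:
  assumes "rack A" "f \<in> rack_hom A B" "g \<in> rack_hom B C"
  shows "compose (carrier A) g f \<in> rack_hom A C"
proof (rule rack_homI)
  fix x y assume "x \<in> carrier A" "y \<in> carrier A"
  then show "compose (carrier A) g f (x \<lhd>\<^bsub>A\<^esub> y)
      = compose (carrier A) g f x \<lhd>\<^bsub>C\<^esub> compose (carrier A) g f y"
    using assms by (simp add: compose_eq rack.act_closed rack_hom_closed rack_hom_act)
next
  fix x assume "x \<in> carrier A"
  then show "compose (carrier A) g f x \<in> carrier C"
    using assms by (simp add: compose_eq rack_hom_closed[of g B] rack_hom_closed[of f A])
qed simp

lemma rack_id_apply [simp]: "x \<in> carrier A \<Longrightarrow> rack_id A x = x"
  by (simp add: rack_id_def)

lemma rack_id_hom: "rack A \<Longrightarrow> rack_id A \<in> rack_hom A A"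
  by (rule rack_homI) (auto simp: rack_id_def rack.act_closed)

lemma rack_surjD:
  "f \<in> rack_surj A B \<Longrightarrow> f \<in> rack_hom A B" "f \<in> rack_surj A B \<Longrightarrow> f ` carrier A = carrier B"
  by (auto simp: rack_surj_def)

lemma Eq_iff: "(a, b) \<in> Eq A f \<longleftrightarrow> a \<in> carrier A \<and> b \<in> carrier A \<and> f a = f b"
  by (auto simp: Eq_def)

lemma congruence_Eq:
  assumes "rack A" "rack B" "f \<in> rack_hom A B"
  shows "congruence A (Eq A f)"
proof -
  have "equiv (carrier A) (Eq A f)"
    by (intro equivI) (auto simp: Eq_iff refl_on_def sym_def trans_def)
  then show ?thesis
    using assms unfolding congruence_def
    by (auto simp: Eq_iff rack.act_closed rack.inv_act_closed rack_hom_act rack_hom_inv_act)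
qed

text \<open>The rack axioms are equations, so they pass to images.\<close>

lemma rack_surj_image:
  assumes "rack A" and surj: "q ` carrier A = carrier B"
    and act: "\<And>x y. x \<in> carrier A \<Longrightarrow> y \<in> carrier A \<Longrightarrow> q x \<lhd>\<^bsub>B\<^esub> q y = q (x \<lhd>\<^bsub>A\<^esub> y)"
    and inv_act: "\<And>x y. x \<in> carrier A \<Longrightarrow> y \<in> carrier A \<Longrightarrow> q x \<lhd>\<inverse>\<^bsub>B\<^esub> q y = q (x \<lhd>\<inverse>\<^bsub>A\<^esub> y)"
  shows "rack B"
proof -
  interpret rack A by fact
  show ?thesis
    by unfold_locales
      (auto simp: act inv_act act_closed inv_act_closed act_inv_act inv_act_act self_distrib[symmetric]
        simp flip: surj)
qed

lemma rack_rack_pullback: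
  assumes "rack A" "rack B" "rack D" "u \<in> rack_hom A D" "v \<in> rack_hom B D"
  shows "rack (rack_pullback A B u v)"
proof -
  interpret A: rack A by fact
  interpret B: rack B by fact
  show ?thesis
    using assms
    by unfold_locales
      (auto simp: rack_pullback_def A.act_closed A.inv_act_closed A.act_inv_act A.inv_act_act
        B.act_closed B.inv_act_closed B.act_inv_act B.inv_act_act rack_hom_act rack_hom_inv_act
        A.self_distrib[symmetric] B.self_distrib[symmetric])
qed

lemma rack_pullback_components:
  assumes C: "rack C" and p: "p \<in> rack_hom C (rack_pullback A B u v)"
  shows "compose (carrier C) fst p \<in> rack_hom C A" "compose (carrier C) snd p \<in> rack_hom C B"
proof -
  have "fst (p x) \<in> carrier A" "snd (p x) \<in> carrier B" if "x \<in> carrier C" for x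
    using rack_hom_closed[OF p that] by (auto simp: rack_pullback_def)
  moreover have "fst (p (x \<lhd>\<^bsub>C\<^esub> y)) = fst (p x) \<lhd>\<^bsub>A\<^esub> fst (p y)"
    "snd (p (x \<lhd>\<^bsub>C\<^esub> y)) = snd (p x) \<lhd>\<^bsub>B\<^esub> snd (p y)" if "x \<in> carrier C" "y \<in> carrier C" for x y
    using rack_hom_act[OF p that] by (simp_all add: rack_pullback_def split_beta)
  ultimately show "compose (carrier C) fst p \<in> rack_hom C A" "compose (carrier C) snd p \<in> rack_hom C B"
    using rack.act_closed[OF C] by (auto intro!: rack_homI simp: compose_eq)
qed

lemma rack_pullback_pair_hom:
  assumes "rack C" "f \<in> rack_hom C A" "g \<in> rack_hom C B"
    and "\<And>x. x \<in> carrier C \<Longrightarrow> u (f x) = v (g x)"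
  shows "(\<lambda>x\<in>carrier C. (f x, g x)) \<in> rack_hom C (rack_pullback A B u v)"
  using assms
  by (intro rack_homI) (auto simp: rack_pullback_def rack_hom_closed rack_hom_act rack.act_closed)


section \<open>Congruences and quotients\<close>

text \<open>The intersection of all congruences containing \<open>P\<close> consists of pairs of elements of the carrier
  only because at least one such congruence, the total relation, exists.\<close>

lemma congruence_cong_gen:
  assumes "rack A" "P \<subseteq> carrier A \<times> carrier A"
  shows "congruence A (cong_gen A P)"
proof -
  let ?T = "carrier A \<times> carrier A"
  have T: "congruence A ?T"
    using assms(1) unfolding congruence_def
    by (auto simp: equiv_def refl_on_def sym_def trans_def rack.act_closed rack.inv_act_closed)
  have sub: "cong_gen A P \<subseteq> ?T"
    unfolding cong_gen_def using T assms(2) by blast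
  have R: "refl_on (carrier A) R" "sym R" "trans R" if "congruence A R" for R
    using that by (auto simp: congruence_def equiv_def)
  have "refl_on (carrier A) (cong_gen A P)"
    using R(1) by (auto simp: cong_gen_def refl_on_def)
  moreover have "sym (cong_gen A P)"
    unfolding cong_gen_def using R(2) by (intro symI) (blast dest: symD)
  moreover have "trans (cong_gen A P)"
    unfolding cong_gen_def using R(3) by (intro transI) (blast dest: transD)
  ultimately have "equiv (carrier A) (cong_gen A P)"
    using sub by (simp add: equiv_def)
  moreover have "(x \<lhd>\<^bsub>A\<^esub> a, y \<lhd>\<^bsub>A\<^esub> b) \<in> R \<and> (x \<lhd>\<inverse>\<^bsub>A\<^esub> a, y \<lhd>\<inverse>\<^bsub>A\<^esub> b) \<in> R"
    if "congruence A R" "P \<subseteq> R" "(x, y) \<in> cong_gen A P" "(a, b) \<in> cong_gen A P" for x y a b R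
  proof -
    have "(x, y) \<in> R" "(a, b) \<in> R" using that by (auto simp: cong_gen_def)
    then show ?thesis using that(1) by (auto simp: congruence_def)
  qed
  ultimately show ?thesis
    unfolding congruence_def[of _ "cong_gen A P"] by (auto simp: cong_gen_def)
qed

lemma cong_gen_least: "congruence A R \<Longrightarrow> P \<subseteq> R \<Longrightarrow> cong_gen A P \<subseteq> R"
  by (auto simp: cong_gen_def)

lemma cong_gen_incl: "P \<subseteq> cong_gen A P"
  by (auto simp: cong_gen_def)

lemma quot_proj_rel:
  assumes "congruence A R" "x \<in> carrier A"
  shows "(x, quot_proj A R x) \<in> R"
proof -
  have "x \<in> R `` {x}"
    using assms by (auto simp: congruence_def equiv_def refl_on_def)
  then have "(SOME y. y \<in> R `` {x}) \<in> R `` {x}" by (rule someI)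
  then show ?thesis using assms(2) by (simp add: quot_proj_def)
qed

lemma quot_proj_eq_iff:
  assumes R: "congruence A R" and "x \<in> carrier A" "y \<in> carrier A"
  shows "quot_proj A R x = quot_proj A R y \<longleftrightarrow> (x, y) \<in> R"
proof
  have eq: "equiv (carrier A) R" using R by (simp add: congruence_def)
  show "(x, y) \<in> R" if "quot_proj A R x = quot_proj A R y"
    using that quot_proj_rel[OF R assms(2)] quot_proj_rel[OF R assms(3)] eq
    by (metis equiv_def symD transD)
  show "quot_proj A R x = quot_proj A R y" if "(x, y) \<in> R"
    using assms(2,3) equiv_class_eq[OF eq that] by (simp only: quot_proj_def restrict_apply if_True)
qed

lemma quot_proj_closed:
  assumes "congruence A R" "x \<in> carrier A"
  shows "quot_proj A R x \<in> carrier A"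
  using quot_proj_rel[OF assms] assms(1) by (auto simp: congruence_def equiv_def)

text \<open>The operations of the quotient are computed on representatives, as \<open>x\<close> and its representative
  are congruent.\<close>

lemma quot_proj_act:
  assumes "rack A" "congruence A R" "x \<in> carrier A" "y \<in> carrier A"
  shows "quot_proj A R x \<lhd>\<^bsub>quot_rack A R\<^esub> quot_proj A R y = quot_proj A R (x \<lhd>\<^bsub>A\<^esub> y)"
    and "quot_proj A R x \<lhd>\<inverse>\<^bsub>quot_rack A R\<^esub> quot_proj A R y = quot_proj A R (x \<lhd>\<inverse>\<^bsub>A\<^esub> y)"
proof -
  note rel = quot_proj_rel[OF assms(2,3)] quot_proj_rel[OF assms(2,4)]
  note closed = quot_proj_closed[OF assms(2,3)] quot_proj_closed[OF assms(2,4)]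
  have "(x \<lhd>\<^bsub>A\<^esub> y, quot_proj A R x \<lhd>\<^bsub>A\<^esub> quot_proj A R y) \<in> R"
    "(x \<lhd>\<inverse>\<^bsub>A\<^esub> y, quot_proj A R x \<lhd>\<inverse>\<^bsub>A\<^esub> quot_proj A R y) \<in> R"
    using assms(2) rel unfolding congruence_def by fast+
  then show "quot_proj A R x \<lhd>\<^bsub>quot_rack A R\<^esub> quot_proj A R y = quot_proj A R (x \<lhd>\<^bsub>A\<^esub> y)"
    and "quot_proj A R x \<lhd>\<inverse>\<^bsub>quot_rack A R\<^esub> quot_proj A R y = quot_proj A R (x \<lhd>\<inverse>\<^bsub>A\<^esub> y)"
    using assms closed
    by (auto simp: quot_rack_def rack.act_closed rack.inv_act_closed simp flip: quot_proj_eq_iff)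
qed

lemma quot_proj_surj:
  assumes "rack A" "congruence A R"
  shows "quot_proj A R \<in> rack_surj A (quot_rack A R)"
proof -
  have "quot_proj A R \<in> rack_hom A (quot_rack A R)"
    using assms by (intro rack_homI) (auto simp: quot_proj_act, auto simp: quot_rack_def quot_proj_def)
  then show ?thesis by (simp add: rack_surj_def quot_rack_def)
qed

lemma rack_quot_rack:
  assumes "rack A" "congruence A R"
  shows "rack (quot_rack A R)"
  by (rule rack_surj_image[OF assms(1), of "quot_proj A R"])
    (auto simp: quot_proj_act[OF assms], auto simp: quot_rack_def)

lemma Eq_quot_proj:
  assumes "congruence A R"
  shows "Eq A (quot_proj A R) = R"
  using assms quot_proj_eq_iff[OF assms]
  by (auto simp: Eq_def congruence_def equiv_def)

text \<open>The factorization is the restriction of \<open>f\<close> to representatives; it takes the right value on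
  each class because \<open>f\<close> is constant on the classes of \<open>R\<close>.\<close>

lemma ex1_quot_factor:
  assumes A: "rack A" and R: "congruence A R" and f: "f \<in> rack_hom A B" and sub: "R \<subseteq> Eq A f"
  shows "\<exists>!h. h \<in> rack_hom (quot_rack A R) B \<and> compose (carrier A) h (quot_proj A R) = f"
proof
  let ?q = "quot_proj A R" and ?Q = "quot_rack A R"
  let ?h = "restrict f (carrier ?Q)"
  have surj: "carrier ?Q = ?q ` carrier A" by (simp add: quot_rack_def)
  have hq: "?h (?q x) = f x" if "x \<in> carrier A" for x
    using quot_proj_rel[OF R that] sub that surj by (auto simp: Eq_iff)
  have "?h \<in> rack_hom ?Q B"
  proof (rule rack_homI)
    fix y z assume "y \<in> carrier ?Q" "z \<in> carrier ?Q"
    then obtain x w where x: "x \<in> carrier A" "y = ?q x" and w: "w \<in> carrier A" "z = ?q w"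
      unfolding surj by blast
    have "?h (y \<lhd>\<^bsub>?Q\<^esub> z) = f (x \<lhd>\<^bsub>A\<^esub> w)"
      unfolding x(2) w(2) quot_proj_act[OF A R x(1) w(1)]
      by (rule hq) (simp add: rack.act_closed A x w)
    then show "?h (y \<lhd>\<^bsub>?Q\<^esub> z) = ?h y \<lhd>\<^bsub>B\<^esub> ?h z"
      using x w by (simp only: hq rack_hom_act[OF f])
  next
    fix y assume "y \<in> carrier ?Q"
    then obtain x where "x \<in> carrier A" "y = ?q x" unfolding surj by blast
    then show "?h y \<in> carrier B" by (simp only: hq rack_hom_closed[OF f])
  qed simp
  moreover have "compose (carrier A) ?h ?q = f"
    by (rule extensionalityI[OF compose_extensional rack_hom_extensional[OF f]])
      (simp only: compose_eq hq)
  ultimately show "?h \<in> rack_hom ?Q B \<and> compose (carrier A) ?h ?q = f" by blast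
  fix h assume h: "h \<in> rack_hom ?Q B \<and> compose (carrier A) h ?q = f"
  show "h = ?h"
  proof (rule extensionalityI[of _ "carrier ?Q"])
    show "h \<in> extensional (carrier ?Q)" using h by (blast intro: rack_hom_extensional)
    show "?h \<in> extensional (carrier ?Q)" by simp
    fix y assume "y \<in> carrier ?Q"
    then obtain x where x: "x \<in> carrier A" "y = ?q x" unfolding surj by blast
    have "h (?q x) = f x" using h x(1) by (metis compose_eq)
    then show "h y = ?h y" by (simp only: x(2) hq[OF x(1)])
  qed
qed


section \<open>The category of double extensions\<close>

lemma compose_eq_compose_iff:
  "compose S f g = compose S h k \<longleftrightarrow> (\<forall>x\<in>S. f (g x) = h (k x))"
  by (auto simp: compose_def fun_eq_iff restrict_def)

lemma ext_hom_iff: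
  "(t, b) \<in> ext_hom f g \<longleftrightarrow> t \<in> rack_hom (etop f) (etop g) \<and> b \<in> rack_hom (ebot f) (ebot g)
    \<and> (\<forall>x\<in>carrier (etop f). emap g (t x) = b (emap f x))"
  by (auto simp: ext_hom_def compose_eq_compose_iff)

lemma arrow_hom_iff:
  "((s, s'), (t, t')) \<in> arrow_hom \<gamma> \<alpha> \<longleftrightarrow>
    s \<in> rack_hom (etop (src \<gamma>)) (etop (src \<alpha>)) \<and> s' \<in> rack_hom (ebot (src \<gamma>)) (ebot (src \<alpha>))
    \<and> t \<in> rack_hom (etop (tgt \<gamma>)) (etop (tgt \<alpha>)) \<and> t' \<in> rack_hom (ebot (tgt \<gamma>)) (ebot (tgt \<alpha>))
    \<and> (\<forall>x\<in>carrier (etop (src \<gamma>)). emap (src \<alpha>) (s x) = s' (emap (src \<gamma>) x))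
    \<and> (\<forall>x\<in>carrier (etop (tgt \<gamma>)). emap (tgt \<alpha>) (t x) = t' (emap (tgt \<gamma>) x))
    \<and> (\<forall>x\<in>carrier (etop (src \<gamma>)). fst (mor \<alpha>) (s x) = t (fst (mor \<gamma>) x))
    \<and> (\<forall>x\<in>carrier (ebot (src \<gamma>)). snd (mor \<alpha>) (s' x) = t' (snd (mor \<gamma>) x))"
  by (auto simp: arrow_hom_def ext_hom_iff ext_comp_def compose_eq_compose_iff)

lemma arrow_homD:
  assumes "((s, s'), (t, t')) \<in> arrow_hom \<gamma> \<alpha>"
  shows "s \<in> rack_hom (etop (src \<gamma>)) (etop (src \<alpha>))" "s' \<in> rack_hom (ebot (src \<gamma>)) (ebot (src \<alpha>))"
    "t \<in> rack_hom (etop (tgt \<gamma>)) (etop (tgt \<alpha>))" "t' \<in> rack_hom (ebot (tgt \<gamma>)) (ebot (tgt \<alpha>))"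
    and "\<And>x. x \<in> carrier (etop (src \<gamma>)) \<Longrightarrow> emap (src \<alpha>) (s x) = s' (emap (src \<gamma>) x)"
    and "\<And>x. x \<in> carrier (etop (tgt \<gamma>)) \<Longrightarrow> emap (tgt \<alpha>) (t x) = t' (emap (tgt \<gamma>) x)"
    and "\<And>x. x \<in> carrier (etop (src \<gamma>)) \<Longrightarrow> fst (mor \<alpha>) (s x) = t (fst (mor \<gamma>) x)"
    and "\<And>x. x \<in> carrier (ebot (src \<gamma>)) \<Longrightarrow> snd (mor \<alpha>) (s' x) = t' (snd (mor \<gamma>) x)"
  using assms unfolding arrow_hom_iff by blast+

lemma arrow_comp_eq:
  "arrow_comp \<gamma> ((u, u'), (v, v')) ((s, s'), (t, t')) =
    ((compose (carrier (etop (src \<gamma>))) u s, compose (carrier (ebot (src \<gamma>))) u' s'),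
     (compose (carrier (etop (tgt \<gamma>))) v t, compose (carrier (ebot (tgt \<gamma>))) v' t'))"
  by (simp add: arrow_comp_def ext_comp_def)

lemma arrow_id_eq:
  "arrow_id \<alpha> = ((rack_id (etop (src \<alpha>)), rack_id (ebot (src \<alpha>))),
    (rack_id (etop (tgt \<alpha>)), rack_id (ebot (tgt \<alpha>))))"
  by (simp add: arrow_id_def ext_id_def)

lemma dextD:
  assumes "\<alpha> \<in> dext"
  shows "rack (etop (src \<alpha>))" "rack (ebot (src \<alpha>))" "rack (etop (tgt \<alpha>))" "rack (ebot (tgt \<alpha>))"
    and "emap (src \<alpha>) \<in> rack_hom (etop (src \<alpha>)) (ebot (src \<alpha>))"
    and "emap (src \<alpha>) ` carrier (etop (src \<alpha>)) = carrier (ebot (src \<alpha>))"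
    and "emap (tgt \<alpha>) \<in> rack_hom (etop (tgt \<alpha>)) (ebot (tgt \<alpha>))"
    and "emap (tgt \<alpha>) ` carrier (etop (tgt \<alpha>)) = carrier (ebot (tgt \<alpha>))"
    and "fst (mor \<alpha>) \<in> rack_hom (etop (src \<alpha>)) (etop (tgt \<alpha>))"
    and "fst (mor \<alpha>) ` carrier (etop (src \<alpha>)) = carrier (etop (tgt \<alpha>))"
    and "snd (mor \<alpha>) \<in> rack_hom (ebot (src \<alpha>)) (ebot (tgt \<alpha>))"
    and "snd (mor \<alpha>) ` carrier (ebot (src \<alpha>)) = carrier (ebot (tgt \<alpha>))"
    and "\<And>x. x \<in> carrier (etop (src \<alpha>)) \<Longrightarrow>
      emap (tgt \<alpha>) (fst (mor \<alpha>) x) = snd (mor \<alpha>) (emap (src \<alpha>) x)"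
    and "\<And>y b. y \<in> carrier (ebot (src \<alpha>)) \<Longrightarrow> b \<in> carrier (etop (tgt \<alpha>)) \<Longrightarrow>
      snd (mor \<alpha>) y = emap (tgt \<alpha>) b \<Longrightarrow>
      \<exists>x\<in>carrier (etop (src \<alpha>)). emap (src \<alpha>) x = y \<and> fst (mor \<alpha>) x = b"
proof -
  have d: "double_extension (src \<alpha>) (tgt \<alpha>) (mor \<alpha>)" using assms by (simp add: dext_def)
  then have m: "(fst (mor \<alpha>), snd (mor \<alpha>)) \<in> ext_hom (src \<alpha>) (tgt \<alpha>)"
    by (simp add: double_extension_def)
  show "rack (etop (src \<alpha>))" "rack (ebot (src \<alpha>))" "rack (etop (tgt \<alpha>))" "rack (ebot (tgt \<alpha>))"
    "emap (src \<alpha>) \<in> rack_hom (etop (src \<alpha>)) (ebot (src \<alpha>))"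
    "emap (src \<alpha>) ` carrier (etop (src \<alpha>)) = carrier (ebot (src \<alpha>))"
    "emap (tgt \<alpha>) \<in> rack_hom (etop (tgt \<alpha>)) (ebot (tgt \<alpha>))"
    "emap (tgt \<alpha>) ` carrier (etop (tgt \<alpha>)) = carrier (ebot (tgt \<alpha>))"
    "fst (mor \<alpha>) ` carrier (etop (src \<alpha>)) = carrier (etop (tgt \<alpha>))"
    "snd (mor \<alpha>) ` carrier (ebot (src \<alpha>)) = carrier (ebot (tgt \<alpha>))"
    using d by (auto simp: double_extension_def extension_def dest: rack_surjD)
  show "fst (mor \<alpha>) \<in> rack_hom (etop (src \<alpha>)) (etop (tgt \<alpha>))"
    "snd (mor \<alpha>) \<in> rack_hom (ebot (src \<alpha>)) (ebot (tgt \<alpha>))"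
    "\<And>x. x \<in> carrier (etop (src \<alpha>)) \<Longrightarrow>
      emap (tgt \<alpha>) (fst (mor \<alpha>) x) = snd (mor \<alpha>) (emap (src \<alpha>) x)"
    using m unfolding ext_hom_iff by blast+
  fix y b assume "y \<in> carrier (ebot (src \<alpha>))" "b \<in> carrier (etop (tgt \<alpha>))"
    "snd (mor \<alpha>) y = emap (tgt \<alpha>) b"
  then have "(y, b) \<in> comparison (src \<alpha>) (mor \<alpha>) ` carrier (etop (src \<alpha>))"
    using d by (simp add: double_extension_def comparison_cod_def rack_pullback_def)
  then show "\<exists>x\<in>carrier (etop (src \<alpha>)). emap (src \<alpha>) x = y \<and> fst (mor \<alpha>) x = b"
    by (auto simp: comparison_def)
qed

text \<open>The top component of \<open>m\<close> is surjective because it is the composite of the comparison map with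
  the projection of the pullback to the top of \<open>g\<close>, and this projection is a pullback of the
  surjective bottom component of \<open>m\<close>.\<close>

lemma double_extensionI:
  assumes "extension f" and g: "extension g" and m: "m \<in> ext_hom f g"
    and bot: "snd m ` carrier (ebot f) = carrier (ebot g)"
    and comp: "\<And>y b. y \<in> carrier (ebot f) \<Longrightarrow> b \<in> carrier (etop g) \<Longrightarrow> snd m y = emap g b \<Longrightarrow>
      \<exists>x\<in>carrier (etop f). emap f x = y \<and> fst m x = b"
  shows "double_extension f g m"
proof -
  have m': "fst m \<in> rack_hom (etop f) (etop g)"
    "\<And>x. x \<in> carrier (etop f) \<Longrightarrow> emap g (fst m x) = snd m (emap f x)"
    using m by (cases m, auto simp: ext_hom_iff)+
  have emap: "emap f \<in> rack_hom (etop f) (ebot f)" "emap g \<in> rack_hom (etop g) (ebot g)"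
    using assms by (auto simp: extension_def dest: rack_surjD)
  have "b \<in> fst m ` carrier (etop f)" if b: "b \<in> carrier (etop g)" for b
  proof -
    obtain y where "y \<in> carrier (ebot f)" "snd m y = emap g b"
      using rack_hom_closed[OF emap(2) b] bot by (metis imageE)
    then show ?thesis using comp b by blast
  qed
  then have top: "fst m ` carrier (etop f) = carrier (etop g)"
    using rack_hom_closed[OF m'(1)] by blast
  have "comparison f m ` carrier (etop f) = carrier (comparison_cod f g m)"
    using comp m' rack_hom_closed[OF emap(1)] rack_hom_closed[OF m'(1)]
    by (fastforce simp: comparison_def comparison_cod_def rack_pullback_def)
  then show ?thesis using assms top by (simp add: double_extension_def)
qed

lemma rack_hom_compose_id:
  assumes "f \<in> rack_hom A B"
  shows "compose (carrier A) f (rack_id A) = f" "compose (carrier A) (rack_id B) f = f"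
  by (rule extensionalityI[of _ "carrier A"]; use assms in
    \<open>auto simp: compose_eq rack_hom_closed intro: rack_hom_extensional\<close>)+

lemma category_Ext2: "category Ext2"
proof
  fix X :: "'a arrow" assume "X \<in> Ob Ext2"
  then have "X \<in> dext" by (simp add: Ext2_def)
  note X = dextD[OF this]
  show "Idt Ext2 X \<in> Hom Ext2 X X"
    by (simp add: Ext2_def arrow_id_eq arrow_hom_iff rack_id_hom X(1-4) rack_hom_closed[OF X(5)]
      rack_hom_closed[OF X(7)] rack_hom_closed[OF X(9)] rack_hom_closed[OF X(11)])
next
  fix X Y Z :: "'a arrow" and f g
  assume *: "X \<in> Ob Ext2" "Y \<in> Ob Ext2" "Z \<in> Ob Ext2" "f \<in> Hom Ext2 X Y" "g \<in> Hom Ext2 Y Z"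
  obtain s s' t t' where f: "f = ((s, s'), (t, t'))" by (metis surj_pair)
  obtain u u' v v' where g: "g = ((u, u'), (v, v'))" by (metis surj_pair)
  have "X \<in> dext" "((s, s'), (t, t')) \<in> arrow_hom X Y" "((u, u'), (v, v')) \<in> arrow_hom Y Z"
    using * by (simp_all add: f g Ext2_def)
  note X = dextD[OF this(1)] and F = arrow_homD[OF this(2)] and G = arrow_homD[OF this(3)]
  have "compose (carrier (etop (src X))) u s \<in> rack_hom (etop (src X)) (etop (src Z))"
    "compose (carrier (ebot (src X))) u' s' \<in> rack_hom (ebot (src X)) (ebot (src Z))"
    "compose (carrier (etop (tgt X))) v t \<in> rack_hom (etop (tgt X)) (etop (tgt Z))"
    "compose (carrier (ebot (tgt X))) v' t' \<in> rack_hom (ebot (tgt X)) (ebot (tgt Z))"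
    using X(1-4) F(1-4) G(1-4) by (blast intro: rack_hom_compose)+
  then show "Comp Ext2 X Y Z g f \<in> Hom Ext2 X Z"
    unfolding f g
    by (simp add: Ext2_def arrow_comp_eq arrow_hom_iff compose_eq F(5-) G(5-)
      rack_hom_closed[OF F(1)] rack_hom_closed[OF F(2)] rack_hom_closed[OF F(3)]
      rack_hom_closed[OF X(5)] rack_hom_closed[OF X(7)] rack_hom_closed[OF X(9)]
      rack_hom_closed[OF X(11)])
next
  fix X Y :: "'a arrow" and f
  assume *: "X \<in> Ob Ext2" "Y \<in> Ob Ext2" "f \<in> Hom Ext2 X Y"
  obtain s s' t t' where f: "f = ((s, s'), (t, t'))" by (metis surj_pair)
  show "Comp Ext2 X X Y f (Idt Ext2 X) = f" "Comp Ext2 X Y Y (Idt Ext2 Y) f = f"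
    using * unfolding f
    by (auto simp: Ext2_def arrow_comp_eq arrow_id_eq arrow_hom_iff rack_hom_compose_id)
next
  fix W X Y Z :: "'a arrow" and f g h
  assume *: "W \<in> Ob Ext2" "X \<in> Ob Ext2" "Y \<in> Ob Ext2" "Z \<in> Ob Ext2"
    "f \<in> Hom Ext2 W X" "g \<in> Hom Ext2 X Y" "h \<in> Hom Ext2 Y Z"
  obtain s s' t t' where f: "f = ((s, s'), (t, t'))" by (metis surj_pair)
  obtain u u' v v' where g: "g = ((u, u'), (v, v'))" by (metis surj_pair)
  obtain x x' y y' where h: "h = ((x, x'), (y, y'))" by (metis surj_pair)
  have "((s, s'), (t, t')) \<in> arrow_hom W X"
    using * by (simp add: f Ext2_def)
  note F = arrow_homD[OF this]
  show "Comp Ext2 W Y Z h (Comp Ext2 W X Y g f) = Comp Ext2 W X Z (Comp Ext2 X Y Z h g) f"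
    unfolding f g h
    by (simp add: Ext2_def arrow_comp_eq compose_eq_compose_iff compose_eq rack_hom_closed[OF F(1)]
      rack_hom_closed[OF F(2)] rack_hom_closed[OF F(3)] rack_hom_closed[OF F(4)])
qed

lemma category_full_subcat:
  assumes "category C"
  shows "category (full_subcat C P)"
  using assms unfolding category_def full_subcat_def by simp

lemma is_functor_inclusion:
  assumes "category C"
  shows "is_functor (full_subcat C P) C inclusion"
  using assms category_full_subcat[OF assms]
  by (auto simp: is_functor_def full_subcat_def inclusion_def)


section \<open>The quotient by the commutator congruence\<close>

lemma squareD:
  assumes "(a, b, c, d) \<in> Eq A f \<box> Eq A g"
  shows "a \<in> carrier A" "b \<in> carrier A" "c \<in> carrier A" "d \<in> carrier A"
    "f a = f b" "f d = f c" "g a = g d" "g b = g c"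
  using assms by (auto simp: square_def Eq_iff)

lemma square_iff:
  "(a, b, c, d) \<in> Eq A f \<box> Eq A g \<longleftrightarrow>
    a \<in> carrier A \<and> b \<in> carrier A \<and> c \<in> carrier A \<and> d \<in> carrier A \<and>
    f a = f b \<and> f d = f c \<and> g a = g d \<and> g b = g c"
  by (auto simp: square_def Eq_iff)

lemma rack_hom_zigzag:
  assumes "rack A" "rack B" "f \<in> rack_hom A B"
    "x \<in> carrier A" "a \<in> carrier A" "b \<in> carrier A" "c \<in> carrier A" "d \<in> carrier A"
  shows "f (x \<lhd>\<^bsub>A\<^esub> a \<lhd>\<inverse>\<^bsub>A\<^esub> b \<lhd>\<^bsub>A\<^esub> c \<lhd>\<inverse>\<^bsub>A\<^esub> d)
    = f x \<lhd>\<^bsub>B\<^esub> f a \<lhd>\<inverse>\<^bsub>B\<^esub> f b \<lhd>\<^bsub>B\<^esub> f c \<lhd>\<inverse>\<^bsub>B\<^esub> f d"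
  using assms by (simp add: rack_hom_act rack_hom_inv_act rack.act_closed rack.inv_act_closed)

lemma double_coveringsD:
  assumes "\<delta> \<in> double_coverings" "x \<in> carrier (etop (src \<delta>))"
    "(a, b, c, d) \<in> Eq (etop (src \<delta>)) (emap (src \<delta>)) \<box> Eq (etop (src \<delta>)) (fst (mor \<delta>))"
  shows "x \<lhd>\<^bsub>etop (src \<delta>)\<^esub> a \<lhd>\<inverse>\<^bsub>etop (src \<delta>)\<^esub> b \<lhd>\<^bsub>etop (src \<delta>)\<^esub> c \<lhd>\<inverse>\<^bsub>etop (src \<delta>)\<^esub> d = x"
  using assms by (auto simp: double_coverings_def Let_def)

lemma double_coverings_dext: "\<delta> \<in> double_coverings \<Longrightarrow> \<delta> \<in> dext"
  by (simp add: double_coverings_def)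

lemma F2_Ob_simps [simp]:
  "etop (src (F2_Ob \<alpha>)) = F2i \<alpha>" "ebot (src (F2_Ob \<alpha>)) = ebot (src \<alpha>)"
  "tgt (F2_Ob \<alpha>) = tgt \<alpha>" "snd (mor (F2_Ob \<alpha>)) = snd (mor \<alpha>)"
  by (simp_all add: F2_Ob_def Let_def)

context
  fixes \<alpha> :: "'a arrow"
  assumes \<alpha>: "\<alpha> \<in> dext"
begin

abbreviation (input) "A_top \<equiv> etop (src \<alpha>)"

lemma congruence_C2: "congruence A_top (C2 \<alpha>)"
  unfolding C2_def commutator_def
  by (rule congruence_cong_gen)
    (auto simp: square_iff dextD[OF \<alpha>] rack.act_closed rack.inv_act_closed)

lemma C2_generator:
  assumes "x \<in> carrier A_top" "(a, b, c, d) \<in> Eq A_top (emap (src \<alpha>)) \<box> Eq A_top (fst (mor \<alpha>))"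
  shows "(x \<lhd>\<^bsub>A_top\<^esub> a \<lhd>\<inverse>\<^bsub>A_top\<^esub> b \<lhd>\<^bsub>A_top\<^esub> c \<lhd>\<inverse>\<^bsub>A_top\<^esub> d, x) \<in> C2 \<alpha>"
  unfolding C2_def commutator_def using assms by (intro cong_gen_incl[THEN subsetD]) blast

text \<open>The kernel pair of a morphism is a congruence, so it contains \<open>C\<^sub>2(\<alpha>)\<close> once it contains the
  generators.\<close>

lemma C2_subset_EqI:
  assumes "rack B" "f \<in> rack_hom A_top B"
    and "\<And>x a b c d. x \<in> carrier A_top \<Longrightarrow>
      (a, b, c, d) \<in> Eq A_top (emap (src \<alpha>)) \<box> Eq A_top (fst (mor \<alpha>)) \<Longrightarrow>
      f x \<lhd>\<^bsub>B\<^esub> f a \<lhd>\<inverse>\<^bsub>B\<^esub> f b \<lhd>\<^bsub>B\<^esub> f c \<lhd>\<inverse>\<^bsub>B\<^esub> f d = f x"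
  shows "C2 \<alpha> \<subseteq> Eq A_top f"
  unfolding C2_def commutator_def
proof (rule cong_gen_least)
  show "congruence A_top (Eq A_top f)" using congruence_Eq assms dextD[OF \<alpha>] by blast
  show "{(x \<lhd>\<^bsub>A_top\<^esub> a \<lhd>\<inverse>\<^bsub>A_top\<^esub> b \<lhd>\<^bsub>A_top\<^esub> c \<lhd>\<inverse>\<^bsub>A_top\<^esub> d, x) |x a b c d.
      x \<in> carrier A_top \<and> (a, b, c, d) \<in> Eq A_top (emap (src \<alpha>)) \<box> Eq A_top (fst (mor \<alpha>))} \<subseteq> Eq A_top f"
  proof clarify
    fix x a b c d
    assume *: "x \<in> carrier A_top" "(a, b, c, d) \<in> Eq A_top (emap (src \<alpha>)) \<box> Eq A_top (fst (mor \<alpha>))"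
    note sq = squareD[OF *(2)]
    have "f (x \<lhd>\<^bsub>A_top\<^esub> a \<lhd>\<inverse>\<^bsub>A_top\<^esub> b \<lhd>\<^bsub>A_top\<^esub> c \<lhd>\<inverse>\<^bsub>A_top\<^esub> d) = f x"
      using rack_hom_zigzag[OF dextD(1)[OF \<alpha>] assms(1,2) *(1) sq(1-4)] assms(3)[OF *] by simp
    then show "(x \<lhd>\<^bsub>A_top\<^esub> a \<lhd>\<inverse>\<^bsub>A_top\<^esub> b \<lhd>\<^bsub>A_top\<^esub> c \<lhd>\<inverse>\<^bsub>A_top\<^esub> d, x) \<in> Eq A_top f"
      using * sq dextD(1)[OF \<alpha>] by (simp add: Eq_iff rack.act_closed rack.inv_act_closed)
  qed
qed

text \<open>Under \<open>f\<^sub>A\<close> the images of \<open>a\<close> and \<open>b\<close> agree and so do those of \<open>c\<close> and \<open>d\<close>, so that the four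
  actions in a generator cancel in adjacent pairs; under \<open>\<alpha>\<^sub>\<top>\<close> the images of \<open>b\<close> and \<open>c\<close> agree and
  so do those of \<open>a\<close> and \<open>d\<close>, and they cancel from the inside.\<close>

lemma C2_subset: "C2 \<alpha> \<subseteq> Eq A_top (emap (src \<alpha>)) \<inter> Eq A_top (fst (mor \<alpha>))"
proof (rule Int_greatest; rule C2_subset_EqI)
  fix x a b c d
  assume x: "x \<in> carrier A_top"
    and sq: "(a, b, c, d) \<in> Eq A_top (emap (src \<alpha>)) \<box> Eq A_top (fst (mor \<alpha>))"
  note sq = squareD[OF sq] and D = dextD[OF \<alpha>]
  let ?f = "emap (src \<alpha>)" and ?g = "fst (mor \<alpha>)"
  show "?f x \<lhd>\<^bsub>ebot (src \<alpha>)\<^esub> ?f a \<lhd>\<inverse>\<^bsub>ebot (src \<alpha>)\<^esub> ?f b \<lhd>\<^bsub>ebot (src \<alpha>)\<^esub> ?f c \<lhd>\<inverse>\<^bsub>ebot (src \<alpha>)\<^esub> ?f d = ?f x"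
    using x sq rack_hom_closed[OF D(5)] by (simp add: rack.act_inv_act D)
  show "?g x \<lhd>\<^bsub>etop (tgt \<alpha>)\<^esub> ?g a \<lhd>\<inverse>\<^bsub>etop (tgt \<alpha>)\<^esub> ?g b \<lhd>\<^bsub>etop (tgt \<alpha>)\<^esub> ?g c \<lhd>\<inverse>\<^bsub>etop (tgt \<alpha>)\<^esub> ?g d = ?g x"
    using x sq rack_hom_closed[OF D(9)]
    by (simp add: rack.act_inv_act rack.inv_act_act rack.act_closed D)
qed (use dextD[OF \<alpha>] in auto)

lemma rack_F2i: "rack (F2i \<alpha>)"
  unfolding F2i_def by (rule rack_quot_rack[OF dextD(1)[OF \<alpha>] congruence_C2])

lemma eta2_top_surj: "eta2_top \<alpha> \<in> rack_surj A_top (F2i \<alpha>)"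
  unfolding F2i_def eta2_top_def by (rule quot_proj_surj[OF dextD(1)[OF \<alpha>] congruence_C2])

lemma eta2_top_hom: "eta2_top \<alpha> \<in> rack_hom A_top (F2i \<alpha>)"
  by (rule rack_surjD(1)[OF eta2_top_surj])

lemma F2i_cases:
  assumes "y \<in> carrier (F2i \<alpha>)"
  obtains x where "x \<in> carrier A_top" "y = eta2_top \<alpha> x"
  using assms rack_surjD(2)[OF eta2_top_surj] by blast

lemma Eq_eta2_top: "Eq A_top (eta2_top \<alpha>) = C2 \<alpha>"
  unfolding eta2_top_def by (rule Eq_quot_proj[OF congruence_C2])

lemma ex1_F2i_factor:
  assumes "f \<in> rack_hom A_top B" "C2 \<alpha> \<subseteq> Eq A_top f"
  shows "\<exists>!h. h \<in> rack_hom (F2i \<alpha>) B \<and> compose (carrier A_top) h (eta2_top \<alpha>) = f"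
  unfolding F2i_def eta2_top_def
  by (rule ex1_quot_factor[OF dextD(1)[OF \<alpha>] congruence_C2 assms])

lemma ex1_comparison_factor: "\<exists>!p'. is_comparison_factor \<alpha> p'"
proof -
  note D = dextD[OF \<alpha>]
  have "comparison (src \<alpha>) (mor \<alpha>) \<in> rack_hom A_top (comparison_cod (src \<alpha>) (tgt \<alpha>) (mor \<alpha>))"
    unfolding comparison_def comparison_cod_def
    by (rule rack_pullback_pair_hom) (auto simp: D)
  moreover have "C2 \<alpha> \<subseteq> Eq A_top (comparison (src \<alpha>) (mor \<alpha>))"
    using C2_subset by (auto simp: comparison_def Eq_def)
  ultimately have "\<exists>!p'. p' \<in> rack_hom (F2i \<alpha>) (comparison_cod (src \<alpha>) (tgt \<alpha>) (mor \<alpha>))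
      \<and> compose (carrier A_top) p' (eta2_top \<alpha>) = comparison (src \<alpha>) (mor \<alpha>)"
    by (rule ex1_F2i_factor)
  then show ?thesis
    unfolding is_comparison_factor_def by (simp add: eq_commute)
qed


section \<open>The reflection of a double extension\<close>

lemma F2_Ob_eq:
  assumes "is_comparison_factor \<alpha> p'"
  shows "F2_Ob \<alpha> =
    \<lparr>src = \<lparr>etop = F2i \<alpha>, ebot = ebot (src \<alpha>), emap = compose (carrier (F2i \<alpha>)) fst p'\<rparr>,
     tgt = tgt \<alpha>, mor = (compose (carrier (F2i \<alpha>)) snd p', snd (mor \<alpha>))\<rparr>"
  using the1_equality[OF ex1_comparison_factor, OF assms] by (simp add: F2_Ob_def)

text \<open>Since the quotient map is surjective, these values are all one needs to know about the two new
  maps of \<open>F\<^sub>2(\<alpha>)\<close>.\<close>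

lemma F2_Ob_eta2_top:
  assumes "x \<in> carrier A_top"
  shows "emap (src (F2_Ob \<alpha>)) (eta2_top \<alpha> x) = emap (src \<alpha>) x"
    and "fst (mor (F2_Ob \<alpha>)) (eta2_top \<alpha> x) = fst (mor \<alpha>) x"
proof -
  obtain p' where p': "is_comparison_factor \<alpha> p'" using ex1_comparison_factor by blast
  have "p' (eta2_top \<alpha> x) = comparison (src \<alpha>) (mor \<alpha>) x"
    using p' assms by (simp add: is_comparison_factor_def compose_eq)
  then show "emap (src (F2_Ob \<alpha>)) (eta2_top \<alpha> x) = emap (src \<alpha>) x"
    and "fst (mor (F2_Ob \<alpha>)) (eta2_top \<alpha> x) = fst (mor \<alpha>) x"
    using assms rack_hom_closed[OF eta2_top_hom assms]
    by (simp_all add: F2_Ob_eq[OF p'] compose_eq comparison_def)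
qed

lemma F2_Ob_homs:
  "emap (src (F2_Ob \<alpha>)) \<in> rack_hom (F2i \<alpha>) (ebot (src \<alpha>))"
  "fst (mor (F2_Ob \<alpha>)) \<in> rack_hom (F2i \<alpha>) (etop (tgt \<alpha>))"
proof -
  obtain p' where p': "is_comparison_factor \<alpha> p'" using ex1_comparison_factor by blast
  then have "p' \<in> rack_hom (F2i \<alpha>)
      (rack_pullback (ebot (src \<alpha>)) (etop (tgt \<alpha>)) (snd (mor \<alpha>)) (emap (tgt \<alpha>)))"
    by (simp add: is_comparison_factor_def comparison_cod_def)
  from rack_pullback_components[OF rack_F2i this]
  show "emap (src (F2_Ob \<alpha>)) \<in> rack_hom (F2i \<alpha>) (ebot (src \<alpha>))"
    "fst (mor (F2_Ob \<alpha>)) \<in> rack_hom (F2i \<alpha>) (etop (tgt \<alpha>))"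
    by (simp_all add: F2_Ob_eq[OF p'])
qed

text \<open>The comparison map of \<open>F\<^sub>2(\<alpha>)\<close> is surjective because that of \<open>\<alpha>\<close> factors through it.\<close>

lemma F2_Ob_dext: "F2_Ob \<alpha> \<in> dext"
proof -
  note D = dextD[OF \<alpha>]
  have "emap (src (F2_Ob \<alpha>)) ` carrier (F2i \<alpha>) = emap (src \<alpha>) ` carrier A_top"
    unfolding rack_surjD(2)[OF eta2_top_surj, symmetric] image_image
    by (rule image_cong) (simp_all add: F2_Ob_eta2_top)
  then have src: "extension (src (F2_Ob \<alpha>))"
    by (simp add: extension_def rack_surj_def D F2_Ob_homs rack_F2i)
  have tgt: "extension (tgt (F2_Ob \<alpha>))"
    by (simp add: extension_def rack_surj_def D)
  have "double_extension (src (F2_Ob \<alpha>)) (tgt (F2_Ob \<alpha>)) (mor (F2_Ob \<alpha>))"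
  proof (rule double_extensionI[OF src tgt])
    have "emap (tgt \<alpha>) (fst (mor (F2_Ob \<alpha>)) y) = snd (mor \<alpha>) (emap (src (F2_Ob \<alpha>)) y)"
      if "y \<in> carrier (F2i \<alpha>)" for y
      using that by (rule F2i_cases) (simp add: F2_Ob_eta2_top D)
    then have "(fst (mor (F2_Ob \<alpha>)), snd (mor (F2_Ob \<alpha>))) \<in> ext_hom (src (F2_Ob \<alpha>)) (tgt (F2_Ob \<alpha>))"
      unfolding ext_hom_iff by (simp add: F2_Ob_homs D)
    then show "mor (F2_Ob \<alpha>) \<in> ext_hom (src (F2_Ob \<alpha>)) (tgt (F2_Ob \<alpha>))"
      unfolding prod.collapse .
    fix y b
    assume "y \<in> carrier (ebot (src (F2_Ob \<alpha>)))" "b \<in> carrier (etop (tgt (F2_Ob \<alpha>)))"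
      "snd (mor (F2_Ob \<alpha>)) y = emap (tgt (F2_Ob \<alpha>)) b"
    then obtain x where "x \<in> carrier A_top" "emap (src \<alpha>) x = y" "fst (mor \<alpha>) x = b"
      using D(14) by auto
    then show "\<exists>z\<in>carrier (etop (src (F2_Ob \<alpha>))).
        emap (src (F2_Ob \<alpha>)) z = y \<and> fst (mor (F2_Ob \<alpha>)) z = b"
      using rack_hom_closed[OF eta2_top_hom] F2_Ob_eta2_top by auto
  qed (simp add: D)
  then show ?thesis by (simp add: dext_def)
qed

text \<open>Any lifts of the corners of a square of \<open>F\<^sub>2(\<alpha>)\<close> form a square of \<open>\<alpha>\<close>, because the maps of
  \<open>F\<^sub>2(\<alpha>)\<close> take the same values on a class as those of \<open>\<alpha>\<close> on its members.\<close>

lemma F2_Ob_covering: "F2_Ob \<alpha> \<in> double_coverings"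
proof -
  let ?Q = "F2i \<alpha>" and ?q = "eta2_top \<alpha>"
  let ?f = "emap (src (F2_Ob \<alpha>))" and ?g = "fst (mor (F2_Ob \<alpha>))"
  have "x \<lhd>\<^bsub>?Q\<^esub> a \<lhd>\<inverse>\<^bsub>?Q\<^esub> b \<lhd>\<^bsub>?Q\<^esub> c \<lhd>\<inverse>\<^bsub>?Q\<^esub> d = x"
    if x: "x \<in> carrier ?Q" and sq: "(a, b, c, d) \<in> Eq ?Q ?f \<box> Eq ?Q ?g" for x a b c d
  proof -
    obtain x' a' b' c' d' where l: "x' \<in> carrier A_top" "x = ?q x'" "a' \<in> carrier A_top" "a = ?q a'"
      "b' \<in> carrier A_top" "b = ?q b'" "c' \<in> carrier A_top" "c = ?q c'" "d' \<in> carrier A_top" "d = ?q d'"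
      using x squareD(1-4)[OF sq] by (metis F2i_cases)
    then have "(a', b', c', d') \<in> Eq A_top (emap (src \<alpha>)) \<box> Eq A_top (fst (mor \<alpha>))"
      using squareD(5-8)[OF sq] by (simp add: square_iff F2_Ob_eta2_top)
    from C2_generator[OF l(1) this]
    have "?q (x' \<lhd>\<^bsub>A_top\<^esub> a' \<lhd>\<inverse>\<^bsub>A_top\<^esub> b' \<lhd>\<^bsub>A_top\<^esub> c' \<lhd>\<inverse>\<^bsub>A_top\<^esub> d') = ?q x'"
      unfolding Eq_eta2_top[symmetric] by (simp add: Eq_iff)
    then show ?thesis
      using rack_hom_zigzag[OF dextD(1)[OF \<alpha>] rack_F2i eta2_top_hom l(1,3,5,7,9)] l by simp
  qed
  then show ?thesis
    using F2_Ob_dext by (auto simp: double_coverings_def Let_def)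
qed


section \<open>The unit\<close>

lemma eta2_hom: "eta2 \<alpha> \<in> arrow_hom \<alpha> (F2_Ob \<alpha>)"
  unfolding eta2_def arrow_hom_iff
  by (auto simp: dextD[OF \<alpha>] rack_id_hom eta2_top_hom F2_Ob_eta2_top
    rack_hom_closed[OF dextD(5)[OF \<alpha>]] rack_hom_closed[OF dextD(7)[OF \<alpha>]]
    rack_hom_closed[OF dextD(9)[OF \<alpha>]] rack_hom_closed[OF dextD(11)[OF \<alpha>]])

text \<open>In the pullback \<open>?E\<close> of \<open>f\<^sub>B\<close> and the source of \<open>F\<^sub>2(\<alpha>)\<close>, formed along identities of \<open>f\<^sub>B\<close>, the
  coordinates in \<open>B\<^sub>\<top>\<close> and \<open>B\<^sub>\<bottom>\<close> are redundant. Its top consists of the pairs of images of elements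
  of \<open>A\<^sub>\<top>\<close>, its bottom is the graph of \<open>\<alpha>\<^sub>\<bottom>\<close> read backwards, and on these parametrizations its map
  is \<open>f\<^sub>A\<close>.\<close>

lemma eta2_three_fold: "three_fold_extension \<alpha> (F2_Ob \<alpha>) (eta2 \<alpha>)"
proof -
  note D = dextD[OF \<alpha>]
  let ?F = "F2_Ob \<alpha>"
  have ext: "extension (src \<alpha>)" "extension (tgt \<alpha>)" "extension (src ?F)"
    using \<alpha> F2_Ob_dext by (auto simp: dext_def double_extension_def)
  have id_image: "rack_id B ` carrier B = carrier B" for B :: "'a rack"
    by (simp add: rack_id_def)
  have "fst (eta2 \<alpha>) \<in> ext_hom (src \<alpha>) (src ?F)" "snd (eta2 \<alpha>) \<in> ext_hom (tgt \<alpha>) (tgt ?F)"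
    using eta2_hom by (auto simp: arrow_hom_def)
  note homs = this
  have 1: "double_extension (src \<alpha>) (src ?F) (fst (eta2 \<alpha>))"
  proof (rule double_extensionI[OF ext(1,3) homs(1)])
    fix y b assume *: "y \<in> carrier (ebot (src \<alpha>))" "b \<in> carrier (etop (src ?F))"
      "snd (fst (eta2 \<alpha>)) y = emap (src ?F) b"
    then obtain x where "x \<in> carrier A_top" "b = eta2_top \<alpha> x" by (auto elim: F2i_cases)
    with * show "\<exists>x\<in>carrier A_top. emap (src \<alpha>) x = y \<and> fst (fst (eta2 \<alpha>)) x = b"
      by (auto simp: eta2_def F2_Ob_eta2_top)
  qed (simp add: eta2_def id_image)
  have 2: "double_extension (tgt \<alpha>) (tgt ?F) (snd (eta2 \<alpha>))"
    by (rule double_extensionI) (use ext homs in \<open>auto simp: eta2_def id_image\<close>)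
  let ?E = "ext_pullback (tgt \<alpha>) (src ?F) (snd (eta2 \<alpha>)) (mor ?F)"
  have top: "carrier (etop ?E) = (\<lambda>x. (fst (mor \<alpha>) x, eta2_top \<alpha> x)) ` carrier A_top"
  proof -
    have "(b, z) \<in> (\<lambda>x. (fst (mor \<alpha>) x, eta2_top \<alpha> x)) ` carrier A_top"
      if "b \<in> carrier (etop (tgt \<alpha>))" "z \<in> carrier (F2i \<alpha>)" "b = fst (mor ?F) z" for b z
      using that(2,1,3) by (elim F2i_cases) (auto simp: F2_Ob_eta2_top)
    then show ?thesis
      using rack_hom_closed[OF D(9)] rack_hom_closed[OF eta2_top_hom]
      by (auto simp: ext_pullback_def rack_pullback_def eta2_def F2_Ob_eta2_top)
  qed
  have bot: "carrier (ebot ?E) = (\<lambda>y. (snd (mor \<alpha>) y, y)) ` carrier (ebot (src \<alpha>))"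
    using rack_hom_closed[OF D(11)] by (auto simp: ext_pullback_def rack_pullback_def eta2_def)
  have emapE: "emap ?E (fst (mor \<alpha>) x, eta2_top \<alpha> x)
      = (snd (mor \<alpha>) (emap (src \<alpha>) x), emap (src \<alpha>) x)" if "x \<in> carrier A_top" for x
  proof -
    have "(fst (mor \<alpha>) x, eta2_top \<alpha> x) \<in> carrier (etop ?E)" using top that by blast
    then show ?thesis using that by (simp add: ext_pullback_def F2_Ob_eta2_top D)
  qed
  have rE: "rack (etop ?E)" "rack (ebot ?E)"
    using rack_rack_pullback[OF D(3) rack_F2i D(3) rack_id_hom[OF D(3)] F2_Ob_homs(2)]
      rack_rack_pullback[OF D(4,2,4) rack_id_hom[OF D(4)] D(11)]
    by (simp_all add: ext_pullback_def eta2_def)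
  have actE: "(x, y) \<lhd>\<^bsub>etop ?E\<^esub> (x', y') = (x \<lhd>\<^bsub>etop (tgt \<alpha>)\<^esub> x', y \<lhd>\<^bsub>F2i \<alpha>\<^esub> y')"
    "(x, y) \<lhd>\<^bsub>ebot ?E\<^esub> (x', y') = (x \<lhd>\<^bsub>ebot (tgt \<alpha>)\<^esub> x', y \<lhd>\<^bsub>ebot (src \<alpha>)\<^esub> y')" for x y x' y'
    by (simp_all add: ext_pullback_def rack_pullback_def)
  have "emap ?E \<in> rack_hom (etop ?E) (ebot ?E)"
  proof (rule rack_homI)
    show "emap ?E \<in> extensional (carrier (etop ?E))"
      by (auto simp: ext_pullback_def)
    fix z assume "z \<in> carrier (etop ?E)"
    then obtain x where x: "x \<in> carrier A_top" "z = (fst (mor \<alpha>) x, eta2_top \<alpha> x)" unfolding top by blast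
    then show "emap ?E z \<in> carrier (ebot ?E)"
      unfolding bot x(2) emapE[OF x(1)] using rack_hom_closed[OF D(5)] by blast
    fix w assume "w \<in> carrier (etop ?E)"
    then obtain y where y: "y \<in> carrier A_top" "w = (fst (mor \<alpha>) y, eta2_top \<alpha> y)" unfolding top by blast
    have xy: "x \<lhd>\<^bsub>A_top\<^esub> y \<in> carrier A_top" using x y D(1) by (simp add: rack.act_closed)
    have "z \<lhd>\<^bsub>etop ?E\<^esub> w = (fst (mor \<alpha>) (x \<lhd>\<^bsub>A_top\<^esub> y), eta2_top \<alpha> (x \<lhd>\<^bsub>A_top\<^esub> y))"
      unfolding x(2) y(2) actE using x y rack_hom_act[OF D(9)] rack_hom_act[OF eta2_top_hom] by simp
    then show "emap ?E (z \<lhd>\<^bsub>etop ?E\<^esub> w) = emap ?E z \<lhd>\<^bsub>ebot ?E\<^esub> emap ?E w"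
      unfolding x(2) y(2) using x(1) y(1) xy
      by (simp add: emapE actE rack_hom_act[OF D(5)] rack_hom_act[OF D(11)] rack_hom_closed[OF D(5)])
  qed
  moreover have "emap ?E ` carrier (etop ?E) = carrier (ebot ?E)"
    unfolding top bot D(6)[symmetric] image_image by (rule image_cong) (simp_all add: emapE)
  ultimately have extE: "extension ?E"
    using rE by (simp add: extension_def rack_surj_def)
  have pair: "ext_pair (src \<alpha>) (mor \<alpha>) (fst (eta2 \<alpha>)) =
      ((\<lambda>x\<in>carrier A_top. (fst (mor \<alpha>) x, eta2_top \<alpha> x)),
       (\<lambda>y\<in>carrier (ebot (src \<alpha>)). (snd (mor \<alpha>) y, y)))"
    by (auto simp: ext_pair_def eta2_def)
  have 3: "double_extension (src \<alpha>) ?E (ext_pair (src \<alpha>) (mor \<alpha>) (fst (eta2 \<alpha>)))"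
  proof (rule double_extensionI[OF ext(1) extE])
    have "(\<lambda>x\<in>carrier A_top. (fst (mor \<alpha>) x, eta2_top \<alpha> x)) \<in> rack_hom A_top (etop ?E)"
    proof (rule rack_homI)
      fix x y assume "x \<in> carrier A_top" "y \<in> carrier A_top"
      then show "(\<lambda>x\<in>carrier A_top. (fst (mor \<alpha>) x, eta2_top \<alpha> x)) (x \<lhd>\<^bsub>A_top\<^esub> y) =
          (\<lambda>x\<in>carrier A_top. (fst (mor \<alpha>) x, eta2_top \<alpha> x)) x \<lhd>\<^bsub>etop ?E\<^esub>
          (\<lambda>x\<in>carrier A_top. (fst (mor \<alpha>) x, eta2_top \<alpha> x)) y"
        using D(1) by (simp add: actE rack.act_closed rack_hom_act[OF D(9)] rack_hom_act[OF eta2_top_hom])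
    qed (simp_all add: top)
    moreover have "(\<lambda>y\<in>carrier (ebot (src \<alpha>)). (snd (mor \<alpha>) y, y)) \<in> rack_hom (ebot (src \<alpha>)) (ebot ?E)"
      using D(2) by (intro rack_homI) (auto simp: bot actE rack.act_closed rack_hom_act[OF D(11)])
    ultimately show "ext_pair (src \<alpha>) (mor \<alpha>) (fst (eta2 \<alpha>)) \<in> ext_hom (src \<alpha>) ?E"
      unfolding pair ext_hom_iff using rack_hom_closed[OF D(5)] by (simp add: emapE)
    show "snd (ext_pair (src \<alpha>) (mor \<alpha>) (fst (eta2 \<alpha>))) ` carrier (ebot (src \<alpha>)) = carrier (ebot ?E)"
      by (simp add: pair bot)
    fix y b
    assume y: "y \<in> carrier (ebot (src \<alpha>))" and "b \<in> carrier (etop ?E)"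
      and eq: "snd (ext_pair (src \<alpha>) (mor \<alpha>) (fst (eta2 \<alpha>))) y = emap ?E b"
    then obtain x where x: "x \<in> carrier A_top" "b = (fst (mor \<alpha>) x, eta2_top \<alpha> x)" unfolding top by blast
    \<comment> \<open>both sides are pairs with a second coordinate in \<open>A\<^sub>\<bottom>\<close>, which is \<open>y\<close> on one and \<open>f\<^sub>A(x)\<close> on
      the other\<close>
    then have "emap (src \<alpha>) x = y" using eq y by (simp add: pair emapE)
    then show "\<exists>x\<in>carrier A_top. emap (src \<alpha>) x = y
        \<and> fst (ext_pair (src \<alpha>) (mor \<alpha>) (fst (eta2 \<alpha>))) x = b"
      using x by (auto simp: pair)
  qed
  show ?thesis
    unfolding three_fold_extension_def using \<alpha> F2_Ob_dext eta2_hom 1 2 3 by simp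
qed

text \<open>A morphism to a double covering sends the squares of \<open>\<alpha>\<close> to squares of the covering, where the
  generating expressions are trivial.\<close>

lemma C2_subset_Eq_hom:
  assumes "\<delta> \<in> double_coverings" "((s, s'), (t, t')) \<in> arrow_hom \<alpha> \<delta>"
  shows "C2 \<alpha> \<subseteq> Eq A_top s"
proof (rule C2_subset_EqI)
  have s: "s \<in> rack_hom A_top (etop (src \<delta>))" using assms(2) by (simp add: arrow_hom_iff)
  then show "s \<in> rack_hom A_top (etop (src \<delta>))" .
  show "rack (etop (src \<delta>))" using dextD(1) double_coverings_dext[OF assms(1)] by blast
  fix x a b c d
  assume x: "x \<in> carrier A_top" and sq: "(a, b, c, d) \<in> Eq A_top (emap (src \<alpha>)) \<box> Eq A_top (fst (mor \<alpha>))"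
  note sq = squareD[OF sq]
  have "(s a, s b, s c, s d) \<in> Eq (etop (src \<delta>)) (emap (src \<delta>)) \<box> Eq (etop (src \<delta>)) (fst (mor \<delta>))"
    using sq rack_hom_closed[OF s] arrow_homD(5,7)[OF assms(2)] by (simp add: square_iff)
  then show "s x \<lhd>\<^bsub>etop (src \<delta>)\<^esub> s a \<lhd>\<inverse>\<^bsub>etop (src \<delta>)\<^esub> s b \<lhd>\<^bsub>etop (src \<delta>)\<^esub> s c \<lhd>\<inverse>\<^bsub>etop (src \<delta>)\<^esub> s d = s x"
    by (rule double_coveringsD[OF assms(1) rack_hom_closed[OF s x]])
qed

lemma arrow_comp_eta2_eq_iff:
  assumes "((h, h'), (k, k')) \<in> arrow_hom (F2_Ob \<alpha>) \<delta>"
  shows "arrow_comp \<alpha> ((h, h'), (k, k')) (eta2 \<alpha>) = ((s, s'), (t, t')) \<longleftrightarrow>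
    compose (carrier A_top) h (eta2_top \<alpha>) = s \<and> h' = s' \<and> k = t \<and> k' = t'"
proof -
  have "h' \<in> rack_hom (ebot (src \<alpha>)) (ebot (src \<delta>))" "k \<in> rack_hom (etop (tgt \<alpha>)) (etop (tgt \<delta>))"
    "k' \<in> rack_hom (ebot (tgt \<alpha>)) (ebot (tgt \<delta>))"
    using assms by (simp_all add: arrow_hom_iff)
  then show ?thesis by (simp add: eta2_def arrow_comp_eq rack_hom_compose_id)
qed

text \<open>Both new equations are between maps out of the quotient, and composing them with the quotient
  map gives equations that hold for the given morphism.\<close>

lemma arrow_hom_F2_ObI:
  assumes m: "((s, s'), (t, t')) \<in> arrow_hom \<alpha> \<delta>"
    and h: "h \<in> rack_hom (F2i \<alpha>) (etop (src \<delta>))" "compose (carrier A_top) h (eta2_top \<alpha>) = s"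
  shows "((h, s'), (t, t')) \<in> arrow_hom (F2_Ob \<alpha>) \<delta>"
proof -
  have "emap (src \<delta>) (h y) = s' (emap (src (F2_Ob \<alpha>)) y)
      \<and> fst (mor \<delta>) (h y) = t (fst (mor (F2_Ob \<alpha>)) y)" if "y \<in> carrier (F2i \<alpha>)" for y
  proof -
    from that obtain x where x: "x \<in> carrier A_top" "y = eta2_top \<alpha> x" by (rule F2i_cases)
    then have "h y = s x" using h(2) by (auto simp: compose_eq)
    then show ?thesis using x arrow_homD(5,7)[OF m x(1)] by (simp add: F2_Ob_eta2_top)
  qed
  then show ?thesis
    using m h(1) by (simp add: arrow_hom_iff)
qed

text \<open>The universal property of the unit: three components of a factorization have to be those of
  \<open>m\<close>, since the unit is an identity there, and the fourth comes from the quotient.\<close>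

lemma ex1_F2_Ob_factor:
  assumes \<delta>: "\<delta> \<in> double_coverings" and m: "m \<in> arrow_hom \<alpha> \<delta>"
  shows "\<exists>!n. n \<in> arrow_hom (F2_Ob \<alpha>) \<delta> \<and> arrow_comp \<alpha> n (eta2 \<alpha>) = m"
proof -
  obtain s s' t t' where m_eq: "m = ((s, s'), (t, t'))" by (metis surj_pair)
  have "s \<in> rack_hom A_top (etop (src \<delta>))" using m by (simp add: m_eq arrow_hom_iff)
  with m have ex1: "\<exists>!h. h \<in> rack_hom (F2i \<alpha>) (etop (src \<delta>)) \<and> compose (carrier A_top) h (eta2_top \<alpha>) = s"
    by (intro ex1_F2i_factor C2_subset_Eq_hom[OF \<delta>]) (auto simp: m_eq)
  then obtain h where h: "h \<in> rack_hom (F2i \<alpha>) (etop (src \<delta>))" "compose (carrier A_top) h (eta2_top \<alpha>) = s"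
    by blast
  have hom: "((h, s'), (t, t')) \<in> arrow_hom (F2_Ob \<alpha>) \<delta>"
    using m h unfolding m_eq by (rule arrow_hom_F2_ObI)
  show ?thesis
  proof
    show "((h, s'), (t, t')) \<in> arrow_hom (F2_Ob \<alpha>) \<delta> \<and> arrow_comp \<alpha> ((h, s'), (t, t')) (eta2 \<alpha>) = m"
      using hom h by (simp add: m_eq arrow_comp_eta2_eq_iff)
    fix n assume n: "n \<in> arrow_hom (F2_Ob \<alpha>) \<delta> \<and> arrow_comp \<alpha> n (eta2 \<alpha>) = m"
    obtain k k' l l' where n_eq: "n = ((k, k'), (l, l'))" by (metis surj_pair)
    have "k \<in> rack_hom (F2i \<alpha>) (etop (src \<delta>))" using n by (simp add: n_eq arrow_hom_iff)
    moreover have comp: "compose (carrier A_top) k (eta2_top \<alpha>) = s \<and> k' = s' \<and> l = t \<and> l' = t'"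
      using n arrow_comp_eta2_eq_iff unfolding n_eq m_eq by blast
    ultimately have "k = h" using ex1 h by blast
    then show "n = ((h, s'), (t, t'))" using comp by (simp add: n_eq)
  qed
qed

end


section \<open>The reflector on morphisms\<close>

lemma arrow_comp_eta2_left:
  assumes "m \<in> arrow_hom \<gamma> \<alpha>"
  shows "arrow_comp \<gamma> (eta2 \<alpha>) m =
    ((compose (carrier (etop (src \<gamma>))) (eta2_top \<alpha>) (fst (fst m)), snd (fst m)), snd m)"
proof -
  obtain s s' t t' where "m = ((s, s'), (t, t'))" by (metis surj_pair)
  with assms show ?thesis
    by (simp add: eta2_def arrow_comp_eq arrow_hom_iff rack_hom_compose_id)
qed

lemma arrow_hom_eta2_left:
  fixes \<gamma> \<alpha> :: "'a arrow"
  assumes "\<gamma> \<in> dext" "\<alpha> \<in> dext" "m \<in> arrow_hom \<gamma> \<alpha>"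
  shows "arrow_comp \<gamma> (eta2 \<alpha>) m \<in> arrow_hom \<gamma> (F2_Ob \<alpha>)"
  using category.Comp_in[OF category_Ext2, of \<gamma> \<alpha> "F2_Ob \<alpha>" m "eta2 \<alpha>"] assms
    eta2_hom[OF assms(2)] F2_Ob_dext[OF assms(2)]
  by (simp add: Ext2_def)

text \<open>The composite of a morphism with the unit of its target is a morphism to a double covering, so
  that its top component factors through the quotient.\<close>

lemma ex1_F2i_map:
  assumes \<gamma>: "\<gamma> \<in> dext" and \<alpha>: "\<alpha> \<in> dext" and m: "((s, s'), (t, t')) \<in> arrow_hom \<gamma> \<alpha>"
  shows "\<exists>!h. is_F2i_map \<gamma> \<alpha> s h"
proof -
  let ?s = "compose (carrier (etop (src \<gamma>))) (eta2_top \<alpha>) s"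
  have c: "((?s, s'), (t, t')) \<in> arrow_hom \<gamma> (F2_Ob \<alpha>)"
    using arrow_hom_eta2_left[OF assms] by (simp add: arrow_comp_eta2_left[OF m])
  then have "?s \<in> rack_hom (etop (src \<gamma>)) (F2i \<alpha>)" by (simp add: arrow_hom_iff)
  then show ?thesis
    unfolding is_F2i_map_def
    by (rule ex1_F2i_factor[OF \<gamma> _ C2_subset_Eq_hom[OF \<gamma> F2_Ob_covering[OF \<alpha>] c]])
qed

lemma F2_Hom_eq:
  assumes "\<gamma> \<in> dext" "\<alpha> \<in> dext" "((s, s'), (t, t')) \<in> arrow_hom \<gamma> \<alpha>" "is_F2i_map \<gamma> \<alpha> s h"
  shows "F2_Hom \<gamma> \<alpha> ((s, s'), (t, t')) = ((h, s'), (t, t'))"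
  using the1_equality[OF ex1_F2i_map[OF assms(1-3)], OF assms(4)] by (simp add: F2_Hom_def)

lemma F2_Hom:
  assumes \<gamma>: "\<gamma> \<in> dext" and \<alpha>: "\<alpha> \<in> dext" and m: "m \<in> arrow_hom \<gamma> \<alpha>"
  shows "F2_Hom \<gamma> \<alpha> m \<in> arrow_hom (F2_Ob \<gamma>) (F2_Ob \<alpha>)"
    and "arrow_comp \<gamma> (F2_Hom \<gamma> \<alpha> m) (eta2 \<gamma>) = arrow_comp \<gamma> (eta2 \<alpha>) m"
proof -
  obtain s s' t t' where m_eq: "m = ((s, s'), (t, t'))" by (metis surj_pair)
  note m' = m[unfolded m_eq]
  obtain h where h: "is_F2i_map \<gamma> \<alpha> s h" using ex1_F2i_map[OF \<gamma> \<alpha> m'] by blast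
  have "((h, s'), (t, t')) \<in> arrow_hom (F2_Ob \<gamma>) (F2_Ob \<alpha>)"
    using arrow_hom_eta2_left[OF \<gamma> \<alpha> m'] h unfolding arrow_comp_eta2_left[OF m']
    by (intro arrow_hom_F2_ObI[OF \<gamma>]) (auto simp: is_F2i_map_def)
  then show "F2_Hom \<gamma> \<alpha> m \<in> arrow_hom (F2_Ob \<gamma>) (F2_Ob \<alpha>)"
    and "arrow_comp \<gamma> (F2_Hom \<gamma> \<alpha> m) (eta2 \<gamma>) = arrow_comp \<gamma> (eta2 \<alpha>) m"
    using h unfolding m_eq F2_Hom_eq[OF \<gamma> \<alpha> m' h] arrow_comp_eta2_left[OF m']
    by (simp_all add: arrow_comp_eta2_eq_iff[OF \<gamma>] is_F2i_map_def)
qed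

lemma F2_Hom_unique:
  assumes "\<gamma> \<in> dext" "\<alpha> \<in> dext" "m \<in> arrow_hom \<gamma> \<alpha>"
    and "n \<in> arrow_hom (F2_Ob \<gamma>) (F2_Ob \<alpha>)" "arrow_comp \<gamma> n (eta2 \<gamma>) = arrow_comp \<gamma> (eta2 \<alpha>) m"
  shows "F2_Hom \<gamma> \<alpha> m = n"
  using ex1_F2_Ob_factor[OF assms(1) F2_Ob_covering[OF assms(2)] arrow_hom_eta2_left[OF assms(1-3)]]
    F2_Hom[OF assms(1-3)] assms(4,5) by blast

text \<open>Functoriality is the pasting of naturality squares of the unit, since \<open>F\<^sub>2\<close> of a morphism is
  the only morphism to make its square commute.\<close>

lemma is_functor_F2: "is_functor Ext2 (full_subcat Ext2 double_coverings) F2"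
proof -
  interpret category "Ext2 :: ('a arrow, ('a, 'a) arrow_mor) cat" by (rule category_Ext2)
  have Ext2_simps: "Ob Ext2 = dext" "Hom Ext2 = arrow_hom" "Idt Ext2 = arrow_id"
    "Comp Ext2 X Y Z g f = arrow_comp X g f" for X Y Z :: "'a arrow" and g f
    by (simp_all add: Ext2_def)
  note cat = Idt_in Comp_in Comp_Idt Idt_Comp Comp_assoc
  note cat = cat[unfolded Ext2_simps]
  have id: "F2_Hom X X (arrow_id X) = arrow_id (F2_Ob X)" if X: "X \<in> dext" for X :: "'a arrow"
  proof -
    note F = F2_Ob_dext[OF X] and e = eta2_hom[OF X]
    have "arrow_comp X (arrow_id (F2_Ob X)) (eta2 X) = eta2 X"
      using X F e by (rule cat)
    moreover have "arrow_comp X (eta2 X) (arrow_id X) = eta2 X"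
      using X F e by (rule cat)
    ultimately show ?thesis
      using X F by (intro F2_Hom_unique cat) auto
  qed
  have comp: "F2_Hom X Z (arrow_comp X g f) = arrow_comp (F2_Ob X) (F2_Hom Y Z g) (F2_Hom X Y f)"
    if X: "X \<in> dext" and Y: "Y \<in> dext" and Z: "Z \<in> dext" and f: "f \<in> arrow_hom X Y" and g: "g \<in> arrow_hom Y Z"
    for X Y Z :: "'a arrow" and f g
  proof (rule F2_Hom_unique[OF X Z])
    note FX = F2_Ob_dext[OF X] and FY = F2_Ob_dext[OF Y] and FZ = F2_Ob_dext[OF Z]
    note Ff = F2_Hom[OF X Y f] and Fg = F2_Hom[OF Y Z g]
    note eX = eta2_hom[OF X] and eY = eta2_hom[OF Y] and eZ = eta2_hom[OF Z]
    show "arrow_comp X g f \<in> arrow_hom X Z" using X Y Z f g by (rule cat)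
    show "arrow_comp (F2_Ob X) (F2_Hom Y Z g) (F2_Hom X Y f) \<in> arrow_hom (F2_Ob X) (F2_Ob Z)"
      using FX FY FZ Ff(1) Fg(1) by (rule cat)
    have "arrow_comp X (arrow_comp (F2_Ob X) (F2_Hom Y Z g) (F2_Hom X Y f)) (eta2 X)
        = arrow_comp X (F2_Hom Y Z g) (arrow_comp X (F2_Hom X Y f) (eta2 X))"
      by (rule cat(5)[OF X FX FY FZ eX Ff(1) Fg(1), symmetric])
    also have "\<dots> = arrow_comp X (F2_Hom Y Z g) (arrow_comp X (eta2 Y) f)"
      by (simp only: Ff)
    also have "\<dots> = arrow_comp X (arrow_comp Y (F2_Hom Y Z g) (eta2 Y)) f"
      by (rule cat(5)[OF X Y FY FZ f eY Fg(1)])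
    also have "\<dots> = arrow_comp X (arrow_comp Y (eta2 Z) g) f"
      by (simp only: Fg)
    also have "\<dots> = arrow_comp X (eta2 Z) (arrow_comp X g f)"
      by (rule cat(5)[OF X Y Z FZ f g eZ, symmetric])
    finally show "arrow_comp X (arrow_comp (F2_Ob X) (F2_Hom Y Z g) (F2_Hom X Y f)) (eta2 X)
        = arrow_comp X (eta2 Z) (arrow_comp X g f)" .
  qed
  show ?thesis
    unfolding is_functor_def
    by (intro conjI category_Ext2 category_full_subcat)
      (simp_all add: full_subcat_def Ext2_simps F2_def F2_Ob_dext F2_Ob_covering F2_Hom(1) id comp)
qed

lemma reflective_F2: "reflective_with Ext2 double_coverings E2 F2 eta2"
proof -
  have bij: "bij_betw (\<lambda>g. arrow_comp X g (eta2 X)) (arrow_hom (F2_Ob X) Y) (arrow_hom X Y)"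
    if X: "X \<in> dext" and Y: "Y \<in> double_coverings" for X Y :: "'a arrow"
  proof (rule bij_betw_imageI)
    have closed: "arrow_comp X g (eta2 X) \<in> arrow_hom X Y" if "g \<in> arrow_hom (F2_Ob X) Y" for g
      using category.Comp_in[OF category_Ext2, of X "F2_Ob X" Y "eta2 X" g] that X
        double_coverings_dext[OF Y] F2_Ob_dext[OF X] eta2_hom[OF X]
      by (simp add: Ext2_def)
    show "inj_on (\<lambda>g. arrow_comp X g (eta2 X)) (arrow_hom (F2_Ob X) Y)"
      using ex1_F2_Ob_factor[OF X Y closed] by (intro inj_onI) metis
    show "(\<lambda>g. arrow_comp X g (eta2 X)) ` arrow_hom (F2_Ob X) Y = arrow_hom X Y"
      using ex1_F2_Ob_factor[OF X Y] closed by blast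
  qed
  then show ?thesis
    unfolding reflective_with_def left_adjoint_with_unit_def
    by (intro conjI is_functor_F2 is_functor_inclusion category_Ext2)
      (simp_all add: Ext2_def full_subcat_def inclusion_def F2_def E2_def eta2_hom F2_Hom(2)
        eta2_three_fold)
qed

theorem theorem4p3p1:
  shows "reflective_with (Ext2 :: ('a arrow, ('a, 'a) arrow_mor) cat) double_coverings E2 F2 eta2
    \<and> (\<forall>\<alpha> \<in> Ob (Ext2 :: ('a arrow, ('a, 'a) arrow_mor) cat).
        let A = etop (src \<alpha>); Q = F2i \<alpha>; q = eta2_top \<alpha> in
          C2 \<alpha> \<subseteq> Eq A (emap (src \<alpha>)) \<inter> Eq A (fst (mor \<alpha>))
        \<and> congruence A (C2 \<alpha>) \<and> rack Q \<and> q \<in> rack_surj A Q \<and> Eq A q = C2 \<alpha>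
        \<and> (\<exists>!p'. is_comparison_factor \<alpha> p')
        \<and> (\<forall>p'. is_comparison_factor \<alpha> p' \<longrightarrow>
              on_Ob F2 \<alpha> =
                \<lparr>src = \<lparr>etop = Q, ebot = ebot (src \<alpha>), emap = compose (carrier Q) fst p'\<rparr>,
                 tgt = tgt \<alpha>,
                 mor = (compose (carrier Q) snd p', snd (mor \<alpha>))\<rparr>)
        \<and> eta2 \<alpha> = ((q, rack_id (ebot (src \<alpha>))),
                     (rack_id (etop (tgt \<alpha>)), rack_id (ebot (tgt \<alpha>))))
        \<and> (\<forall>\<delta> \<in> (double_coverings :: 'b arrow set). \<forall>m \<in> arrow_hom \<alpha> \<delta>.
              \<exists>!n. n \<in> arrow_hom (on_Ob F2 \<alpha>) \<delta> \<and> arrow_comp \<alpha> n (eta2 \<alpha>) = m))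
    \<and> (\<forall>\<gamma> \<in> Ob (Ext2 :: ('a arrow, ('a, 'a) arrow_mor) cat). \<forall>\<alpha> \<in> Ob Ext2.
        \<forall>s s' t t'. ((s, s'), (t, t')) \<in> Hom Ext2 \<gamma> \<alpha> \<longrightarrow>
          (\<exists>!h. is_F2i_map \<gamma> \<alpha> s h)
        \<and> (\<forall>h. is_F2i_map \<gamma> \<alpha> s h \<longrightarrow>
              on_Hom F2 \<gamma> \<alpha> ((s, s'), (t, t')) = ((h, s'), (t, t'))))"
proof -
  have simps: "Ob (Ext2 :: ('a arrow, ('a, 'a) arrow_mor) cat) = dext"
    "Hom (Ext2 :: ('a arrow, ('a, 'a) arrow_mor) cat) = arrow_hom"
    "on_Ob F2 \<alpha> = F2_Ob \<alpha>" "on_Hom F2 \<gamma> \<alpha> = F2_Hom \<gamma> \<alpha>" for \<gamma> \<alpha> :: "'a arrow"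
    by (simp_all add: Ext2_def F2_def)
  show ?thesis
    unfolding Let_def simps
    by (intro conjI ballI allI impI reflective_F2 C2_subset congruence_C2 rack_F2i eta2_top_surj
      Eq_eta2_top ex1_comparison_factor F2_Ob_eq eta2_def ex1_F2_Ob_factor ex1_F2i_map F2_Hom_eq;
      assumption)
qed

end
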